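(* A 3-dimensional quasi-para-Sasakian manifold $(M,\varphi,\eta,\xi,g)$ is locally $\varphi$-symmetric if and only if its scalar curvature $\mathrm{scal}$ is constant.
   Context: An almost paracontact metric manifold $(M,\varphi,\eta,\xi,g)$ is a smooth manifold $M$ of dimension $2n+1$ ($n\ge 1$; here $n=1$) with a $(1,1)$-tensor field $\varphi$, a vector field $\xi$, a 1-form $\eta$ and a pseudo-Riemannian metric $g$ such that $\varphi\xi=0$, $\eta\circ\varphi=0$, $\eta(\xi)=1$, $\varphi^2=\mathrm{id}-\eta\otimes\xi$, $\varphi$ induces an almost paracomplex structure on each fibre of $\mathbb D=\ker\eta$, and $g(\varphi X,\varphi Y)=-g(X,Y)+\eta(X)\eta(Y)$ for all $X,Y$ (hence $\eta(X)=g(X,\xi)$ and $g$ has signature $(n+1,n)$). It is quasi-para-Sasakian if $(\nabla_X\varphi)Y=g(X,Y)\xi-\eta(Y)X$ for all vector fields $X,Y$, where $\nabla$ is the Levi-Civita connection of $g$. The curvature tensor is $R(X,Y)Z=\nabla_X\nabla_YZ-\nabla_Y\nabla_XZ-\nabla_{[X,Y]}Z$, $\mathrm{Ric}(Y,Z)=\mathrm{tr}(X\mapsto R(X,Y)Z)$, and $\mathrm{scal}$ is the $g$-trace of $\mathrm{Ric}$. The structure is locally $\varphi$-symmetric if $\varphi^2\big((\nabla_WR)(X,Y)Z\big)=0$ for all vector fields $W,X,Y,Z$ orthogonal to $\xi$.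
   Formalization: The manifold M is assumed connected; otherwise a disjoint union of two locally φ-symmetric quasi-para-Sasakian 3-manifolds with different constant scalar curvatures is locally φ-symmetric while scal is not constant. *)

theory Defs
  imports "HOL-Analysis.Analysis"
begin

text \<open>Smoothness on an open set S of a Euclidean space.\<close>

primrec Ck_on :: "nat \<Rightarrow> 'e::euclidean_space set \<Rightarrow> ('e \<Rightarrow> 'b::real_normed_vector) \<Rightarrow> bool" where
  "Ck_on 0 S f \<longleftrightarrow> continuous_on S f"
| "Ck_on (Suc k) S f \<longleftrightarrow>
     (\<forall>x\<in>S. f differentiable (at x)) \<and>
     (\<forall>v. Ck_on k S (\<lambda>x. frechet_derivative f (at x) v))"

definition smooth_on :: "'e::euclidean_space set \<Rightarrow> ('e \<Rightarrow> 'b::real_normed_vector) \<Rightarrow> bool" where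
  "smooth_on S f \<longleftrightarrow> (\<forall>k. Ck_on k S f)"


text \<open>A chart is a pair (domain, coordinate map); the coordinate map is only meaningful on the
  domain.  A smooth structure is given by a (not necessarily maximal) smooth atlas.\<close>

type_synonym ('a, 'n) chart = "'a set \<times> ('a \<Rightarrow> real^'n)"

definition is_chart :: "'a topology \<Rightarrow> ('a, 'n::finite) chart \<Rightarrow> bool" where
  "is_chart M c \<longleftrightarrow> openin M (fst c) \<and> open (snd c ` fst c) \<and>
     homeomorphic_map (subtopology M (fst c)) (top_of_set (snd c ` fst c)) (snd c)"

definition chart_inv :: "('a, 'n::finite) chart \<Rightarrow> real^'n \<Rightarrow> 'a" where
  "chart_inv c = inv_into (fst c) (snd c)"

definition coord_change ::
    "('a, 'n::finite) chart \<Rightarrow> ('a, 'n) chart \<Rightarrow> real^'n \<Rightarrow> real^'n" where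
  "coord_change c d = snd d \<circ> chart_inv c"

definition smooth_manifold :: "'a topology \<Rightarrow> ('a, 'n::finite) chart set \<Rightarrow> bool" where
  "smooth_manifold M A \<longleftrightarrow>
     Hausdorff_space M \<and> second_countable M \<and>
     (\<forall>c\<in>A. is_chart M c) \<and> topspace M = (\<Union>c\<in>A. fst c) \<and>
     (\<forall>c\<in>A. \<forall>d\<in>A. smooth_on (snd c ` (fst c \<inter> fst d)) (coord_change c d))"


text \<open>Tangent spaces.  Every point p gets a preferred chart, \<open>chart_at A p\<close>, and a tangent vector
  at p is represented by its components in that chart, so that the tangent space at p is
  \<open>real^'n\<close>.  The preferred chart jumps from point to point, hence smoothness of a vector field is
  tested on its components in a fixed chart, obtained with the Jacobian of the change of
  coordinates.\<close>

definition chart_at :: "('a, 'n::finite) chart set \<Rightarrow> 'a \<Rightarrow> ('a, 'n) chart" where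
  "chart_at A p = (SOME c. c \<in> A \<and> p \<in> fst c)"

definition tangent_change ::
    "('a, 'n::finite) chart \<Rightarrow> ('a, 'n) chart \<Rightarrow> 'a \<Rightarrow> real^'n \<Rightarrow> real^'n" where
  "tangent_change c d p v = frechet_derivative (coord_change c d) (at (snd c p)) v"

definition smooth_funs :: "('a, 'n::finite) chart set \<Rightarrow> 'a set \<Rightarrow> ('a \<Rightarrow> real) set" where
  "smooth_funs A U =
     {f. \<forall>c\<in>A. smooth_on (snd c ` (fst c \<inter> U)) (f \<circ> chart_inv c)}"

text \<open>Vector fields on an open subset U; the values outside U are irrelevant.\<close>

definition vector_fields :: "('a, 'n::finite) chart set \<Rightarrow> 'a set \<Rightarrow> ('a \<Rightarrow> real^'n) set" where
  "vector_fields A U =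
     {X. \<forall>c\<in>A. smooth_on (snd c ` (fst c \<inter> U))
        ((\<lambda>q. tangent_change (chart_at A q) c q (X q)) \<circ> chart_inv c)}"

text \<open>\<open>field_deriv A X f\<close> is the function X f.\<close>

definition field_deriv ::
    "('a, 'n::finite) chart set \<Rightarrow> ('a \<Rightarrow> real^'n) \<Rightarrow> ('a \<Rightarrow> real) \<Rightarrow> 'a \<Rightarrow> real" where
  "field_deriv A X f p =
     frechet_derivative (f \<circ> chart_inv (chart_at A p)) (at (snd (chart_at A p) p)) (X p)"

text \<open>[X, Y] acts on functions as X Y - Y X, so its k-th component at p is the value of this
  commutator on the k-th coordinate function of the preferred chart at p.\<close>

definition lie_bracket ::
    "('a, 'n::finite) chart set \<Rightarrow> ('a \<Rightarrow> real^'n) \<Rightarrow> ('a \<Rightarrow> real^'n) \<Rightarrow> 'a \<Rightarrow> real^'n" where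
  "lie_bracket A X Y p =
     (\<chi> k. let x = (\<lambda>q. snd (chart_at A p) q $ k) in
        field_deriv A X (field_deriv A Y x) p - field_deriv A Y (field_deriv A X x) p)"

text \<open>The extension of a tangent vector v at p to a vector field on the domain of the preferred
  chart at p, with constant components in that chart.\<close>

definition vec_extension ::
    "('a, 'n::finite) chart set \<Rightarrow> 'a \<Rightarrow> real^'n \<Rightarrow> 'a \<Rightarrow> real^'n" where
  "vec_extension A p v q = tangent_change (chart_at A p) (chart_at A q) q v"


definition pseudo_riemannian_metric ::
    "'a topology \<Rightarrow> ('a, 'n::finite) chart set \<Rightarrow> ('a \<Rightarrow> real^'n \<Rightarrow> real^'n \<Rightarrow> real) \<Rightarrow> bool" where
  "pseudo_riemannian_metric M A g \<longleftrightarrow>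
     (\<forall>p\<in>topspace M. bilinear (g p) \<and> (\<forall>u v. g p u v = g p v u) \<and>
        (\<forall>u. (\<forall>v. g p u v = 0) \<longrightarrow> u = 0)) \<and>
     (\<forall>U. openin M U \<longrightarrow> (\<forall>X\<in>vector_fields A U. \<forall>Y\<in>vector_fields A U.
        (\<lambda>p. g p (X p) (Y p)) \<in> smooth_funs A U))"

text \<open>Connections are taken as operators on vector fields over arbitrary open subsets (the whole
  manifold included), with values depending only on the restrictions of the arguments to U.  A
  connection on globally defined fields extends uniquely to such an operator.  All later conditions
  on vector fields are tensorial, so imposing them over open subsets or globally is the same.\<close>

definition affine_connection ::
    "'a topology \<Rightarrow> ('a, 'n::finite) chart set \<Rightarrow>
     (('a \<Rightarrow> real^'n) \<Rightarrow> ('a \<Rightarrow> real^'n) \<Rightarrow> 'a \<Rightarrow> real^'n) \<Rightarrow> bool" where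
  "affine_connection M A nabla \<longleftrightarrow> (\<forall>U. openin M U \<longrightarrow>
     (\<forall>X\<in>vector_fields A U. \<forall>Y\<in>vector_fields A U. nabla X Y \<in> vector_fields A U) \<and>
     (\<forall>X\<in>vector_fields A U. \<forall>X'\<in>vector_fields A U.
      \<forall>Y\<in>vector_fields A U. \<forall>Y'\<in>vector_fields A U.
        (\<forall>p\<in>U. X p = X' p \<and> Y p = Y' p) \<longrightarrow> (\<forall>p\<in>U. nabla X Y p = nabla X' Y' p)) \<and>
     (\<forall>X\<in>vector_fields A U. \<forall>X'\<in>vector_fields A U. \<forall>Y\<in>vector_fields A U. \<forall>p\<in>U.
        nabla (\<lambda>q. X q + X' q) Y p = nabla X Y p + nabla X' Y p) \<and>
     (\<forall>f\<in>smooth_funs A U. \<forall>X\<in>vector_fields A U. \<forall>Y\<in>vector_fields A U. \<forall>p\<in>U.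
        nabla (\<lambda>q. f q *\<^sub>R X q) Y p = f p *\<^sub>R nabla X Y p) \<and>
     (\<forall>X\<in>vector_fields A U. \<forall>Y\<in>vector_fields A U. \<forall>Y'\<in>vector_fields A U. \<forall>p\<in>U.
        nabla X (\<lambda>q. Y q + Y' q) p = nabla X Y p + nabla X Y' p) \<and>
     (\<forall>f\<in>smooth_funs A U. \<forall>X\<in>vector_fields A U. \<forall>Y\<in>vector_fields A U. \<forall>p\<in>U.
        nabla X (\<lambda>q. f q *\<^sub>R Y q) p = field_deriv A X f p *\<^sub>R Y p + f p *\<^sub>R nabla X Y p))"

definition levi_civita ::
    "'a topology \<Rightarrow> ('a, 'n::finite) chart set \<Rightarrow> ('a \<Rightarrow> real^'n \<Rightarrow> real^'n \<Rightarrow> real) \<Rightarrow>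
     (('a \<Rightarrow> real^'n) \<Rightarrow> ('a \<Rightarrow> real^'n) \<Rightarrow> 'a \<Rightarrow> real^'n) \<Rightarrow> bool" where
  "levi_civita M A g nabla \<longleftrightarrow> affine_connection M A nabla \<and> (\<forall>U. openin M U \<longrightarrow>
     (\<forall>X\<in>vector_fields A U. \<forall>Y\<in>vector_fields A U. \<forall>p\<in>U.
        nabla X Y p - nabla Y X p = lie_bracket A X Y p) \<and>
     (\<forall>X\<in>vector_fields A U. \<forall>Y\<in>vector_fields A U. \<forall>Z\<in>vector_fields A U. \<forall>p\<in>U.
        field_deriv A X (\<lambda>q. g q (Y q) (Z q)) p =
          g p (nabla X Y p) (Z p) + g p (Y p) (nabla X Z p)))"

definition curvature ::
    "('a, 'n::finite) chart set \<Rightarrow> (('a \<Rightarrow> real^'n) \<Rightarrow> ('a \<Rightarrow> real^'n) \<Rightarrow> 'a \<Rightarrow> real^'n) \<Rightarrow>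
     ('a \<Rightarrow> real^'n) \<Rightarrow> ('a \<Rightarrow> real^'n) \<Rightarrow> ('a \<Rightarrow> real^'n) \<Rightarrow> 'a \<Rightarrow> real^'n" where
  "curvature A nabla X Y Z p =
     nabla X (nabla Y Z) p - nabla Y (nabla X Z) p - nabla (lie_bracket A X Y) Z p"

text \<open>The curvature is tensorial, so its value on tangent vectors at p is computed with any
  extensions to vector fields near p.\<close>

definition curvature_at ::
    "('a, 'n::finite) chart set \<Rightarrow> (('a \<Rightarrow> real^'n) \<Rightarrow> ('a \<Rightarrow> real^'n) \<Rightarrow> 'a \<Rightarrow> real^'n) \<Rightarrow>
     'a \<Rightarrow> real^'n \<Rightarrow> real^'n \<Rightarrow> real^'n \<Rightarrow> real^'n" where
  "curvature_at A nabla p u v w =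
     curvature A nabla (vec_extension A p u) (vec_extension A p v) (vec_extension A p w) p"

definition ricci ::
    "('a, 'n::finite) chart set \<Rightarrow> (('a \<Rightarrow> real^'n) \<Rightarrow> ('a \<Rightarrow> real^'n) \<Rightarrow> 'a \<Rightarrow> real^'n) \<Rightarrow>
     'a \<Rightarrow> real^'n \<Rightarrow> real^'n \<Rightarrow> real" where
  "ricci A nabla p v w = trace (matrix (\<lambda>u. curvature_at A nabla p u v w))"

definition gram_matrix :: "('a \<Rightarrow> real^'n::finite \<Rightarrow> real^'n \<Rightarrow> real) \<Rightarrow> 'a \<Rightarrow> real^'n^'n" where
  "gram_matrix g p = (\<chi> i j. g p (axis i 1) (axis j 1))"

definition scalar_curvature ::
    "('a, 'n::finite) chart set \<Rightarrow> ('a \<Rightarrow> real^'n \<Rightarrow> real^'n \<Rightarrow> real) \<Rightarrow>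
     (('a \<Rightarrow> real^'n) \<Rightarrow> ('a \<Rightarrow> real^'n) \<Rightarrow> 'a \<Rightarrow> real^'n) \<Rightarrow> 'a \<Rightarrow> real" where
  "scalar_curvature A g nabla p =
     (\<Sum>i\<in>UNIV. \<Sum>j\<in>UNIV.
        matrix_inv (gram_matrix g p) $ i $ j * ricci A nabla p (axis i 1) (axis j 1))"

text \<open>The value of (nabla_W R)(X, Y)Z.\<close>

definition nabla_curvature ::
    "('a, 'n::finite) chart set \<Rightarrow> (('a \<Rightarrow> real^'n) \<Rightarrow> ('a \<Rightarrow> real^'n) \<Rightarrow> 'a \<Rightarrow> real^'n) \<Rightarrow>
     ('a \<Rightarrow> real^'n) \<Rightarrow> ('a \<Rightarrow> real^'n) \<Rightarrow> ('a \<Rightarrow> real^'n) \<Rightarrow> ('a \<Rightarrow> real^'n) \<Rightarrow> 'a \<Rightarrow> real^'n" where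
  "nabla_curvature A nabla W X Y Z p =
     nabla W (curvature A nabla X Y Z) p
     - curvature A nabla (nabla W X) Y Z p
     - curvature A nabla X (nabla W Y) Z p
     - curvature A nabla X Y (nabla W Z) p"


text \<open>The almost paracomplex condition on the fibres of ker eta says that phi squares to the identity
  there (part of the equation for phi composed with itself) and that its eigenspaces for 1 and -1
  have the same dimension.\<close>

definition almost_paracontact_metric ::
    "'a topology \<Rightarrow> ('a, 'n::finite) chart set \<Rightarrow> ('a \<Rightarrow> real^'n \<Rightarrow> real^'n) \<Rightarrow>
     ('a \<Rightarrow> real^'n \<Rightarrow> real) \<Rightarrow> ('a \<Rightarrow> real^'n) \<Rightarrow>
     ('a \<Rightarrow> real^'n \<Rightarrow> real^'n \<Rightarrow> real) \<Rightarrow> bool" where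
  "almost_paracontact_metric M A phi eta xi g \<longleftrightarrow>
     (\<exists>m\<ge>1. CARD('n) = 2 * m + 1) \<and>
     pseudo_riemannian_metric M A g \<and>
     xi \<in> vector_fields A (topspace M) \<and>
     (\<forall>p\<in>topspace M. linear (phi p) \<and> linear (eta p)) \<and>
     (\<forall>U. openin M U \<longrightarrow> (\<forall>X\<in>vector_fields A U.
        (\<lambda>p. phi p (X p)) \<in> vector_fields A U \<and> (\<lambda>p. eta p (X p)) \<in> smooth_funs A U)) \<and>
     (\<forall>p\<in>topspace M.
        phi p (xi p) = 0 \<and>
        (\<forall>v. eta p (phi p v) = 0) \<and>
        eta p (xi p) = 1 \<and>
        (\<forall>v. phi p (phi p v) = v - eta p v *\<^sub>R xi p) \<and>
        dim {v. eta p v = 0 \<and> phi p v = v} = dim {v. eta p v = 0 \<and> phi p v = - v} \<and>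
        (\<forall>u v. g p (phi p u) (phi p v) = - g p u v + eta p u * eta p v))"

definition quasi_para_sasakian ::
    "'a topology \<Rightarrow> ('a, 'n::finite) chart set \<Rightarrow> ('a \<Rightarrow> real^'n \<Rightarrow> real^'n) \<Rightarrow>
     ('a \<Rightarrow> real^'n \<Rightarrow> real) \<Rightarrow> ('a \<Rightarrow> real^'n) \<Rightarrow>
     ('a \<Rightarrow> real^'n \<Rightarrow> real^'n \<Rightarrow> real) \<Rightarrow>
     (('a \<Rightarrow> real^'n) \<Rightarrow> ('a \<Rightarrow> real^'n) \<Rightarrow> 'a \<Rightarrow> real^'n) \<Rightarrow> bool" where
  "quasi_para_sasakian M A phi eta xi g nabla \<longleftrightarrow>
     almost_paracontact_metric M A phi eta xi g \<and>
     (\<forall>U. openin M U \<longrightarrow> (\<forall>X\<in>vector_fields A U. \<forall>Y\<in>vector_fields A U. \<forall>p\<in>U.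
        nabla X (\<lambda>q. phi q (Y q)) p - phi p (nabla X Y p) =
          g p (X p) (Y p) *\<^sub>R xi p - eta p (Y p) *\<^sub>R X p))"

definition locally_phi_symmetric ::
    "'a topology \<Rightarrow> ('a, 'n::finite) chart set \<Rightarrow> ('a \<Rightarrow> real^'n \<Rightarrow> real^'n) \<Rightarrow>
     ('a \<Rightarrow> real^'n) \<Rightarrow> ('a \<Rightarrow> real^'n \<Rightarrow> real^'n \<Rightarrow> real) \<Rightarrow>
     (('a \<Rightarrow> real^'n) \<Rightarrow> ('a \<Rightarrow> real^'n) \<Rightarrow> 'a \<Rightarrow> real^'n) \<Rightarrow> bool" where
  "locally_phi_symmetric M A phi xi g nabla \<longleftrightarrow>
     (\<forall>U. openin M U \<longrightarrow>
       (\<forall>W\<in>vector_fields A U. \<forall>X\<in>vector_fields A U.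
        \<forall>Y\<in>vector_fields A U. \<forall>Z\<in>vector_fields A U.
          (\<forall>p\<in>U. g p (W p) (xi p) = 0 \<and> g p (X p) (xi p) = 0 \<and>
                  g p (Y p) (xi p) = 0 \<and> g p (Z p) (xi p) = 0) \<longrightarrow>
          (\<forall>p\<in>U. phi p (phi p (nabla_curvature A nabla W X Y Z p)) = 0)))"

end

theory Submission
  imports Defs
begin

text \<open>The structure equation gives \<open>\<nabla>\<^sub>X \<xi> = \<phi> X\<close> and hence \<open>R(X, Y)\<xi> = \<eta>(X)Y - \<eta>(Y)X\<close>.  In dimension 3
  the plane field \<open>D = ker \<eta>\<close> has rank 2, so the symmetries of the curvature tensor leave a single
  unknown function \<open>K\<close>, with \<open>scal = 2K - 4\<close> and
  \<open>R(X, Y)Z \<equiv> K (g(Y, Z)X - g(X, Z)Y)\<close> modulo \<open>\<xi>\<close> whenever two of the arguments lie in \<open>D\<close>.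
  Differentiating, \<open>\<phi>\<^sup>2((\<nabla>\<^sub>W R)(X, Y)Z) = (W K)(g(Y, Z)X - g(X, Z)Y)\<close> on \<open>D\<close>, so local
  \<open>\<phi>\<close>-symmetry means that \<open>K\<close> is constant along \<open>D\<close>.  As \<open>\<eta>([E, \<phi>E]) = 2g(E, E)\<close> for \<open>E\<close> in \<open>D\<close>,
  brackets of fields in \<open>D\<close> recover \<open>\<xi>\<close>; then \<open>K\<close> is locally constant, hence constant because \<open>M\<close> is
  connected.\<close>

section \<open>Smooth maps between Euclidean spaces\<close>

text \<open>On D the metric has signature (1,1), so a unit frame would need square roots and a
  choice of sign. The computations use \<xi>, E, \<phi>E instead, for any E in D with h = g(E, E)
  \<noteq> 0; then g(\<phi>E, \<phi>E) = -h, and the sectional curvature K of D is a quotient with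
  denominator -h^2. The Ricci tensor comes out as (K - 1)g on D and -2 on \<xi>, whence scal = 2(K -
  1) - 2. Before K can be differentiated it must be known to be independent of E and smooth: its
  expression through scal gives the former, the quotient for a local field E the latter. Covariant
  differentiation leads out of D, but the curvature terms created this way are multiples of \<xi>,
  which \<phi>^2 removes. Tangent vectors are stored in charts that jump from point to point, so
  anything that is differentiated twice must be rewritten in a fixed chart. The symmetry of second
  derivatives then makes [X, Y] act on every smooth function as a commutator, on which the
  tensoriality of R and the Jacobi identity rest.\<close>

lemma frechet_derivative_eqI:
  "(f has_derivative f') (at x) \<Longrightarrow> frechet_derivative f (at x) = f'"
  by (metis frechet_derivative_at)

text \<open>The derivative at a point depends on a full neighbourhood; since S is open, agreement on
  S passes to all derivatives. Formulas valid only inside a chart are transferred this way.\<close>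

lemma Ck_on_cong:
  assumes "open S" "Ck_on k S f" "\<forall>x\<in>S. f x = g x"
  shows "Ck_on k S g"
  using assms(2,3)
proof (induction k arbitrary: f g)
  case 0
  then show ?case by (metis Ck_on.simps(1) continuous_on_cong)
next
  case (Suc k)
  have D: "(g has_derivative frechet_derivative f (at x)) (at x)" if "x \<in> S" for x
    by (rule has_derivative_transform_within_open[OF _ \<open>open S\<close> that,
          where f = f and t = UNIV])
       (use Suc.prems that in \<open>auto simp: frechet_derivative_works\<close>)
  have "Ck_on k S (\<lambda>x. frechet_derivative g (at x) v)" for v
    by (rule Suc.IH[of "\<lambda>x. frechet_derivative f (at x) v"])
      (use Suc.prems in \<open>auto simp: frechet_derivative_eqI[OF D]\<close>)
  then show ?case using D by (auto simp: differentiable_def)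
qed

text \<open>Turns an explicit derivative into a proof of differentiability class, so that each
  closure property below is an induction on k whose hypothesis is applied to the formula for
  \<open>f'\<close>.\<close>

lemma Ck_on_SucI:
  assumes "open S" "\<And>x. x \<in> S \<Longrightarrow> (f has_derivative f' x) (at x)"
    and "\<And>v. Ck_on k S (\<lambda>x. f' x v)"
  shows "Ck_on (Suc k) S f"
proof -
  have "Ck_on k S (\<lambda>x. frechet_derivative f (at x) v)" for v
    by (rule Ck_on_cong[OF \<open>open S\<close> assms(3)[of v]])
      (simp add: frechet_derivative_eqI[OF assms(2)])
  then show ?thesis
    using assms(2) by (auto simp: differentiable_def)
qed

lemma Ck_on_subset:
  assumes "Ck_on k S f" "T \<subseteq> S"
  shows "Ck_on k T f"
  using assms by (induction k arbitrary: f) (auto intro: continuous_on_subset)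

lemma Ck_on_has_derivative:
  assumes "Ck_on (Suc k) S f" "x \<in> S"
  shows "(f has_derivative frechet_derivative f (at x)) (at x)"
  using assms by (simp add: frechet_derivative_works)

lemma Ck_on_SucD: "Ck_on (Suc k) S f \<Longrightarrow> Ck_on k S f"
proof (induction k arbitrary: f)
  case 0
  then show ?case
    by (auto intro!: continuous_at_imp_continuous_on differentiable_imp_continuous_within)
qed auto

lemma Ck_on_const: "Ck_on k S (\<lambda>x. c)"
  by (induction k arbitrary: c) auto

lemma Ck_on_add:
  assumes "open S" "Ck_on k S f" "Ck_on k S g"
  shows "Ck_on k S (\<lambda>x. f x + g x)"
  using assms(2,3)
proof (induction k arbitrary: f g)
  case 0
  then show ?case by (auto intro: continuous_intros)
next
  case (Suc k)
  show ?case
    by (rule Ck_on_SucI[OF \<open>open S\<close>,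
          where f' = "\<lambda>x v. frechet_derivative f (at x) v + frechet_derivative g (at x) v"])
       (use Suc in \<open>auto intro!: has_derivative_add Ck_on_has_derivative\<close>)
qed

lemma Ck_on_sum:
  assumes "open S" "\<And>i. i \<in> I \<Longrightarrow> Ck_on k S (f i)"
  shows "Ck_on k S (\<lambda>x. \<Sum>i\<in>I. f i x)"
  using assms(2)
  by (induction I rule: infinite_finite_induct) (auto intro: Ck_on_const Ck_on_add[OF \<open>open S\<close>])

lemma Ck_on_bilinear:
  assumes "open S" "bounded_bilinear B" "Ck_on k S f" "Ck_on k S g"
  shows "Ck_on k S (\<lambda>x. B (f x) (g x))"
  using assms(3,4)
proof (induction k arbitrary: f g)
  case 0
  then show ?case by (simp add: bounded_bilinear.continuous_on[OF assms(2)])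
next
  case (Suc k)
  note D = Ck_on_SucD[OF Suc.prems(1)] Ck_on_SucD[OF Suc.prems(2)]
  show ?case
    by (rule Ck_on_SucI[OF \<open>open S\<close>,
          where f' = "\<lambda>x v. B (f x) (frechet_derivative g (at x) v) +
            B (frechet_derivative f (at x) v) (g x)"])
       (use Suc D in \<open>auto intro!: bounded_bilinear.FDERIV[OF assms(2)] Ck_on_has_derivative
         Ck_on_add[OF \<open>open S\<close>]\<close>)
qed

lemma Ck_on_linear:
  assumes "open S" "bounded_linear L" "Ck_on k S f"
  shows "Ck_on k S (\<lambda>x. L (f x))"
  using assms(3)
proof (induction k arbitrary: f)
  case 0
  then show ?case by (simp add: bounded_linear.continuous_on[OF assms(2)])
next
  case (Suc k)
  show ?case
    by (rule Ck_on_SucI[OF \<open>open S\<close>,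
          where f' = "\<lambda>x v. L (frechet_derivative f (at x) v)"])
       (use Suc in \<open>auto intro!: bounded_linear.has_derivative[OF assms(2)] Ck_on_has_derivative\<close>)
qed

text \<open>\<open>Ck_on\<close> controls derivatives in fixed directions only; expanding in a basis
  handles a direction that moves with the point.\<close>

lemma frechet_derivative_expand:
  fixes f :: "'e::euclidean_space \<Rightarrow> 'b::real_normed_vector"
  assumes "f differentiable (at x)"
  shows "frechet_derivative f (at x) v = (\<Sum>b\<in>Basis. (v \<bullet> b) *\<^sub>R frechet_derivative f (at x) b)"
proof -
  interpret linear "frechet_derivative f (at x)"
    by (rule linear_frechet_derivative[OF assms])
  have "frechet_derivative f (at x) v = frechet_derivative f (at x) (\<Sum>b\<in>Basis. (v \<bullet> b) *\<^sub>R b)"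
    by (simp add: euclidean_representation)
  then show ?thesis by (simp add: sum scale)
qed

lemma Ck_on_frechet:
  assumes "open S" "Ck_on (Suc k) S f" "Ck_on k S v"
  shows "Ck_on k S (\<lambda>x. frechet_derivative f (at x) (v x))"
proof (rule Ck_on_cong[OF \<open>open S\<close>])
  show "Ck_on k S (\<lambda>x. \<Sum>b\<in>Basis. (v x \<bullet> b) *\<^sub>R frechet_derivative f (at x) b)"
    using assms by (intro Ck_on_sum Ck_on_bilinear[OF _ bounded_bilinear_scaleR]
       Ck_on_linear[OF _ bounded_linear_inner_left]) auto
  show "\<forall>x\<in>S. (\<Sum>b\<in>Basis. (v x \<bullet> b) *\<^sub>R frechet_derivative f (at x) b) =
      frechet_derivative f (at x) (v x)"
    using assms(2) by (auto simp: frechet_derivative_expand[symmetric])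
qed

lemma Ck_on_compose:
  fixes f :: "'e::euclidean_space \<Rightarrow> 'b::real_normed_vector"
    and h :: "'d::euclidean_space \<Rightarrow> 'e"
  assumes "open S" "Ck_on k T f" "Ck_on k S h" "h ` S \<subseteq> T"
  shows "Ck_on k S (f \<circ> h)"
  using assms(2,3)
proof (induction k arbitrary: f)
  case 0
  then show ?case using assms(4) by (auto simp: o_def intro: continuous_on_compose2)
next
  case (Suc k)
  let ?f = "\<lambda>x. frechet_derivative f (at (h x))" and ?h = "\<lambda>x. frechet_derivative h (at x)"
  show ?case
  proof (rule Ck_on_SucI[OF \<open>open S\<close>, where f' = "\<lambda>x v. ?f x (?h x v)"])
    fix x assume "x \<in> S"
    then show "(f \<circ> h has_derivative (\<lambda>v. ?f x (?h x v))) (at x)"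
      using diff_chain_at[OF Ck_on_has_derivative[OF Suc.prems(2)] Ck_on_has_derivative[OF Suc.prems(1)]]
        assms(4) by (auto simp: o_def)
  next
    fix v
    \<comment> \<open>The chain rule involves the partial derivatives of f along h, so the
      hypothesis is needed for them in place of f; this is why f is arbitrary in the
      induction.\<close>
    have "Ck_on k S ((\<lambda>y. frechet_derivative f (at y) b) \<circ> h)" for b
      by (rule Suc.IH) (use Suc.prems Ck_on_SucD in auto)
    then have "Ck_on k S (\<lambda>x. \<Sum>b\<in>Basis. (?h x v \<bullet> b) *\<^sub>R ?f x b)"
      using Suc.prems \<open>open S\<close> by (intro Ck_on_sum Ck_on_bilinear[OF _ bounded_bilinear_scaleR]
       Ck_on_linear[OF _ bounded_linear_inner_left]) (auto simp: o_def)
    then show "Ck_on k S (\<lambda>x. ?f x (?h x v))"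
      by (rule Ck_on_cong[OF \<open>open S\<close>])
        (use Suc.prems(1) assms(4) in \<open>auto simp: image_subset_iff frechet_derivative_expand[symmetric]\<close>)
  qed
qed

text \<open>The derivative of 1/f contains 1/f again, and its class is supplied by the induction
  hypothesis for the same f.\<close>

lemma Ck_on_inverse:
  fixes f :: "'e::euclidean_space \<Rightarrow> real"
  assumes "open S" "Ck_on k S f" "\<forall>x\<in>S. f x \<noteq> 0"
  shows "Ck_on k S (\<lambda>x. inverse (f x))"
  using assms(2)
proof (induction k)
  case 0
  then show ?case using assms(3) by (auto intro: continuous_intros)
next
  case (Suc k)
  note IH = Suc.IH[OF Ck_on_SucD[OF Suc.prems]]
  show ?case
  proof (rule Ck_on_SucI[OF \<open>open S\<close>,
        where f' = "\<lambda>x v. - (inverse (f x) * frechet_derivative f (at x) v * inverse (f x))"])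
    fix x assume "x \<in> S"
    then show "((\<lambda>x. inverse (f x)) has_derivative
        (\<lambda>v. - (inverse (f x) * frechet_derivative f (at x) v * inverse (f x)))) (at x)"
      by (intro Deriv.has_derivative_inverse Ck_on_has_derivative[OF Suc.prems]) (use assms(3) in auto)
  next
    fix v
    show "Ck_on k S (\<lambda>x. - (inverse (f x) * frechet_derivative f (at x) v * inverse (f x)))"
      using Suc.prems IH
      by (intro Ck_on_linear[OF \<open>open S\<close> bounded_linear_minus[OF bounded_linear_ident]]
          Ck_on_bilinear[OF \<open>open S\<close> bounded_bilinear_mult]) auto
  qed
qed

lemma smooth_on_has_derivative:
  "smooth_on S f \<Longrightarrow> x \<in> S \<Longrightarrow> (f has_derivative frechet_derivative f (at x)) (at x)"
  unfolding smooth_on_def by (metis Ck_on_has_derivative)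

lemma smooth_on_differentiable: "smooth_on S f \<Longrightarrow> x \<in> S \<Longrightarrow> f differentiable (at x)"
  using smooth_on_has_derivative differentiable_def by blast

lemma smooth_on_continuous: "smooth_on S f \<Longrightarrow> continuous_on S f"
  unfolding smooth_on_def by (metis Ck_on.simps(1))

lemma smooth_on_cong: "open S \<Longrightarrow> smooth_on S f \<Longrightarrow> (\<And>x. x \<in> S \<Longrightarrow> f x = g x) \<Longrightarrow> smooth_on S g"
  unfolding smooth_on_def using Ck_on_cong by metis

lemma smooth_on_subset: "smooth_on S f \<Longrightarrow> T \<subseteq> S \<Longrightarrow> smooth_on T f"
  unfolding smooth_on_def using Ck_on_subset by metis

lemma smooth_on_const: "smooth_on S (\<lambda>x. c)"
  unfolding smooth_on_def by (simp add: Ck_on_const)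

lemma smooth_on_add: "open S \<Longrightarrow> smooth_on S f \<Longrightarrow> smooth_on S g \<Longrightarrow> smooth_on S (\<lambda>x. f x + g x)"
  unfolding smooth_on_def by (simp add: Ck_on_add)

lemma smooth_on_bilinear:
  "open S \<Longrightarrow> bounded_bilinear B \<Longrightarrow> smooth_on S f \<Longrightarrow> smooth_on S g \<Longrightarrow>
   smooth_on S (\<lambda>x. B (f x) (g x))"
  unfolding smooth_on_def by (simp add: Ck_on_bilinear)

lemma smooth_on_linear:
  "open S \<Longrightarrow> bounded_linear L \<Longrightarrow> smooth_on S f \<Longrightarrow> smooth_on S (\<lambda>x. L (f x))"
  unfolding smooth_on_def by (simp add: Ck_on_linear)

lemma smooth_on_frechet:
  "open S \<Longrightarrow> smooth_on S f \<Longrightarrow> smooth_on S v \<Longrightarrow>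
   smooth_on S (\<lambda>x. frechet_derivative f (at x) (v x))"
  unfolding smooth_on_def by (simp add: Ck_on_frechet del: Ck_on.simps)

lemma smooth_on_compose:
  "open S \<Longrightarrow> smooth_on T f \<Longrightarrow> smooth_on S h \<Longrightarrow> h ` S \<subseteq> T \<Longrightarrow> smooth_on S (f \<circ> h)"
  unfolding smooth_on_def by (blast intro: Ck_on_compose)

lemma smooth_on_inverse:
  fixes f :: "'e::euclidean_space \<Rightarrow> real"
  shows "open S \<Longrightarrow> smooth_on S f \<Longrightarrow> \<forall>x\<in>S. f x \<noteq> 0 \<Longrightarrow> smooth_on S (\<lambda>x. inverse (f x))"
  unfolding smooth_on_def by (intro allI Ck_on_inverse) auto

text \<open>Two applications of the mean value theorem to the second difference quotient.\<close>

lemma second_difference: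
  fixes f :: "'e::euclidean_space \<Rightarrow> real"
  assumes S: "smooth_on S f" and h: "0 < h"
    and B: "\<And>s t. s \<in> {0..h} \<Longrightarrow> t \<in> {0..h} \<Longrightarrow> x + s *\<^sub>R u + t *\<^sub>R v \<in> S"
  obtains s t where "s \<in> {0..h}" "t \<in> {0..h}"
    "f (x + h *\<^sub>R u + h *\<^sub>R v) - f (x + h *\<^sub>R u) - f (x + h *\<^sub>R v) + f x =
     h * h * frechet_derivative (\<lambda>y. frechet_derivative f (at y) u) (at (x + s *\<^sub>R u + t *\<^sub>R v)) v"
proof -
  let ?D = "\<lambda>y. frechet_derivative f (at y) u"
  have D: "((\<lambda>r. F (a + r *\<^sub>R w)) has_derivative (\<lambda>d. d * frechet_derivative F (at (a + r *\<^sub>R w)) w))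
      (at r within T)" if "F differentiable (at (a + r *\<^sub>R w))"
    for F :: "'e \<Rightarrow> real" and a w r T
  proof -
    have 1: "((\<lambda>r. a + r *\<^sub>R w) has_derivative (\<lambda>d. d *\<^sub>R w)) (at r within T)"
      by (auto intro!: derivative_eq_intros)
    have lin: "linear (frechet_derivative F (at (a + r *\<^sub>R w)))"
      by (rule linear_frechet_derivative[OF that])
    have 2: "(F has_derivative frechet_derivative F (at (a + r *\<^sub>R w)))
      (at (a + r *\<^sub>R w) within (\<lambda>r. a + r *\<^sub>R w) ` T)"
      using that by (simp add: frechet_derivative_works has_derivative_at_withinI)
    show ?thesis
      using diff_chain_within[OF 1 2] by (simp add: o_def linear_scale[OF lin])
  qed
  have Sf: "f differentiable (at y)" if "y \<in> S" for y
    using smooth_on_differentiable[OF S that] .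
  have SD: "?D differentiable (at y)" if "y \<in> S" for y
  proof -
    have "Ck_on (Suc (Suc 0)) S f" using S unfolding smooth_on_def by blast
    then show ?thesis using that by simp
  qed
  have "\<exists>s\<in>{0<..<h}. (f (x + h *\<^sub>R v + h *\<^sub>R u) - f (x + h *\<^sub>R u)) - (f (x + h *\<^sub>R v + 0 *\<^sub>R u) - f (x + 0 *\<^sub>R u))
      = (h - 0) * ?D (x + h *\<^sub>R v + s *\<^sub>R u) - (h - 0) * ?D (x + s *\<^sub>R u)"
    by (rule mvt_simple[OF h, where f = "\<lambda>s. f (x + h *\<^sub>R v + s *\<^sub>R u) - f (x + s *\<^sub>R u)"
      and f' = "\<lambda>s d. d * ?D (x + h *\<^sub>R v + s *\<^sub>R u) - d * ?D (x + s *\<^sub>R u)"])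
      (intro has_derivative_diff D Sf; use B[of _ h] B[of _ 0] h in \<open>auto simp: add_ac\<close>)
  then obtain s where s: "s \<in> {0<..<h}" and
    1: "f (x + h *\<^sub>R u + h *\<^sub>R v) - f (x + h *\<^sub>R u) - f (x + h *\<^sub>R v) + f x =
      h * (?D (x + s *\<^sub>R u + h *\<^sub>R v) - ?D (x + s *\<^sub>R u))"
    by (auto simp: algebra_simps)
  have "\<exists>t\<in>{0<..<h}. ?D (x + s *\<^sub>R u + h *\<^sub>R v) - ?D (x + s *\<^sub>R u + 0 *\<^sub>R v)
      = (h - 0) * frechet_derivative ?D (at (x + s *\<^sub>R u + t *\<^sub>R v)) v"
    by (rule mvt_simple[OF h, where f = "\<lambda>t. ?D (x + s *\<^sub>R u + t *\<^sub>R v)"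
      and f' = "\<lambda>t d. d * frechet_derivative ?D (at (x + s *\<^sub>R u + t *\<^sub>R v)) v"])
      (intro D SD; use B[of s] s in auto)
  then obtain t where "t \<in> {0<..<h}"
    "?D (x + s *\<^sub>R u + h *\<^sub>R v) - ?D (x + s *\<^sub>R u)
      = h * frechet_derivative ?D (at (x + s *\<^sub>R u + t *\<^sub>R v)) v"
    by auto
  with 1 s show ?thesis by (intro that[of s t]) auto
qed

text \<open>The second difference over a small parallelogram does not change when u and v are
  exchanged, and it equals \<open>h * h\<close> times either mixed derivative at some nearby point.
  Continuity of both mixed derivatives at x excludes a gap between them.\<close>

lemma symmetric_second_derivative:
  fixes f :: "'e::euclidean_space \<Rightarrow> real"
  assumes "open S" and S: "smooth_on S f" and x: "x \<in> S"
  shows "frechet_derivative (\<lambda>y. frechet_derivative f (at y) u) (at x) v =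
    frechet_derivative (\<lambda>y. frechet_derivative f (at y) v) (at x) u" (is "?F x = ?G x")
proof (rule ccontr)
  assume ne: "?F x \<noteq> ?G x"
  \<comment> \<open>Half the supposed gap: two errors below e cannot bridge it.\<close>
  define e where "e = \<bar>?F x - ?G x\<bar> / 2"
  have e: "e > 0" using ne by (simp add: e_def)
  have "Ck_on (Suc (Suc 0)) S f" using S unfolding smooth_on_def by blast
  then have "continuous_on S ?F" "continuous_on S ?G" by auto
  then have "isCont ?F x" "isCont ?G x"
    using \<open>open S\<close> x by (simp_all add: continuous_on_eq_continuous_at)
  then obtain d1 d2 where d: "d1 > 0" "d2 > 0"
    and F: "\<And>y. dist y x < d1 \<Longrightarrow> \<bar>?F y - ?F x\<bar> < e"
    and G: "\<And>y. dist y x < d2 \<Longrightarrow> \<bar>?G y - ?G x\<bar> < e"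
    unfolding continuous_at_eps_delta dist_real_def using e by metis
  obtain d3 where d3: "d3 > 0" "ball x d3 \<subseteq> S" using \<open>open S\<close> x openE by blast
  define r where "r = min d1 (min d2 d3)"
  \<comment> \<open>Keeps the whole parallelogram spanned by hu and hv strictly inside the ball of
    radius r; the summand 1 gives strictness and covers u = v = 0.\<close>
  define h where "h = r / (norm u + norm v + 1)"
  have r: "r > 0" using d d3 by (simp add: r_def)
  have n: "norm u + norm v + 1 > 0" by (smt (verit) norm_ge_zero)
  have h: "h > 0" using r n by (simp add: h_def)
  have near: "dist (x + s *\<^sub>R u + t *\<^sub>R v) x < r" if "s \<in> {0..h}" "t \<in> {0..h}" for s t
  proof -
    have "dist (x + s *\<^sub>R u + t *\<^sub>R v) x = norm (s *\<^sub>R u + t *\<^sub>R v)"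
      by (simp add: dist_norm add.assoc)
    also have "\<dots> \<le> s * norm u + t * norm v"
      using that norm_triangle_ineq[of "s *\<^sub>R u" "t *\<^sub>R v"] by simp
    also have "\<dots> \<le> h * norm u + h * norm v"
      using that by (intro add_mono mult_right_mono) auto
    also have "\<dots> < h * (norm u + norm v + 1)" using h by (simp add: algebra_simps)
    also have "\<dots> = r" using n by (simp add: h_def)
    finally show ?thesis .
  qed
  have B: "x + s *\<^sub>R u + t *\<^sub>R v \<in> S" if "s \<in> {0..h}" "t \<in> {0..h}" for s t
    using near[OF that] d3 by (auto simp: r_def dist_commute)
  obtain s t where 1: "s \<in> {0..h}" "t \<in> {0..h}"
    "f (x + h *\<^sub>R u + h *\<^sub>R v) - f (x + h *\<^sub>R u) - f (x + h *\<^sub>R v) + f x =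
     h * h * ?F (x + s *\<^sub>R u + t *\<^sub>R v)"
    using second_difference[OF S h B] by metis
  have B': "x + s *\<^sub>R v + t *\<^sub>R u \<in> S" if "s \<in> {0..h}" "t \<in> {0..h}" for s t
    using B[OF that(2,1)] by (simp add: add_ac)
  obtain s' t' where 2: "s' \<in> {0..h}" "t' \<in> {0..h}"
    "f (x + h *\<^sub>R v + h *\<^sub>R u) - f (x + h *\<^sub>R v) - f (x + h *\<^sub>R u) + f x =
     h * h * ?G (x + s' *\<^sub>R v + t' *\<^sub>R u)"
    using second_difference[OF S h B'] by metis
  have "h * h * ?F (x + s *\<^sub>R u + t *\<^sub>R v) = h * h * ?G (x + s' *\<^sub>R v + t' *\<^sub>R u)"
    using 1(3) 2(3) by (simp add: algebra_simps)
  then have eq: "?F (x + s *\<^sub>R u + t *\<^sub>R v) = ?G (x + s' *\<^sub>R v + t' *\<^sub>R u)" using h by simp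
  have "\<bar>?F (x + s *\<^sub>R u + t *\<^sub>R v) - ?F x\<bar> < e"
    using near[OF 1(1,2)] by (intro F) (simp add: r_def)
  moreover have "\<bar>?G (x + s' *\<^sub>R v + t' *\<^sub>R u) - ?G x\<bar> < e"
    using near[OF 2(2,1)] by (intro G) (simp add: r_def add_ac)
  ultimately have "\<bar>?F x - ?G x\<bar> < 2 * e" using eq by linarith
  then show False by (simp add: e_def)
qed

section \<open>Functions and vector fields on a manifold\<close>

text \<open>Product rule for the derivative of f paired with a moving direction. In a commutator of
  two fields the first summand is symmetric and cancels, so only the second survives.\<close>

lemma frechet_derivative_apply:
  fixes f :: "'e::euclidean_space \<Rightarrow> real" and v :: "'e \<Rightarrow> 'e"
  assumes S: "open S" "smooth_on S f" "smooth_on S v" and x: "x \<in> S"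
  shows "frechet_derivative (\<lambda>y. frechet_derivative f (at y) (v y)) (at x) u =
    frechet_derivative (\<lambda>y. frechet_derivative f (at y) (v x)) (at x) u +
    frechet_derivative f (at x) (frechet_derivative v (at x) u)"
proof -
  let ?D = "\<lambda>b y. frechet_derivative f (at y) b"
  have sD: "smooth_on S (?D b)" for b
    by (rule smooth_on_frechet[OF S(1,2) smooth_on_const])
  have D: "(?D b has_derivative frechet_derivative (?D b) (at x)) (at x)" for b
    by (rule smooth_on_has_derivative[OF sD x])
  have dv: "(v has_derivative frechet_derivative v (at x)) (at x)"
    by (rule smooth_on_has_derivative[OF S(3) x])
  have exp: "?D w y = (\<Sum>b\<in>Basis. (w \<bullet> b) * ?D b y)" if "y \<in> S" for w y
    using frechet_derivative_expand[OF smooth_on_differentiable[OF S(2) that], of w] by simp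
  have 1: "((\<lambda>y. \<Sum>b\<in>Basis. (v y \<bullet> b) * ?D b y) has_derivative
      (\<lambda>u. \<Sum>b\<in>Basis. (v x \<bullet> b) * frechet_derivative (?D b) (at x) u +
         (frechet_derivative v (at x) u \<bullet> b) * ?D b x)) (at x)"
    by (intro has_derivative_sum has_derivative_mult D
        bounded_linear.has_derivative[OF bounded_linear_inner_left dv])
  have 2: "((\<lambda>y. \<Sum>b\<in>Basis. (v x \<bullet> b) * ?D b y) has_derivative
      (\<lambda>u. \<Sum>b\<in>Basis. (v x \<bullet> b) * frechet_derivative (?D b) (at x) u)) (at x)"
    by (intro has_derivative_sum has_derivative_mult_right D)
  have "frechet_derivative (\<lambda>y. frechet_derivative f (at y) (v y)) (at x) =
      (\<lambda>u. \<Sum>b\<in>Basis. (v x \<bullet> b) * frechet_derivative (?D b) (at x) u +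
         (frechet_derivative v (at x) u \<bullet> b) * ?D b x)"
    by (rule frechet_derivative_eqI, rule has_derivative_transform_within_open[OF 1 S(1) x])
      (simp add: exp[symmetric])
  moreover have "frechet_derivative (\<lambda>y. frechet_derivative f (at y) (v x)) (at x) =
      (\<lambda>u. \<Sum>b\<in>Basis. (v x \<bullet> b) * frechet_derivative (?D b) (at x) u)"
    by (rule frechet_derivative_eqI, rule has_derivative_transform_within_open[OF 2 S(1) x])
      (simp add: exp[symmetric])
  ultimately show ?thesis
    by (simp add: sum.distrib exp[OF x, symmetric])
qed

lemma frechet_derivative_cong_open:
  assumes "open S" "x \<in> S" "smooth_on S f" "\<And>y. y \<in> S \<Longrightarrow> f y = g y"
  shows "frechet_derivative g (at x) = frechet_derivative f (at x)"
  by (rule frechet_derivative_eqI, rule has_derivative_transform_within_open[OF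
      smooth_on_has_derivative[OF assms(3,2)] assms(1,2)]) (rule assms(4))

locale smooth_mfd =
  fixes M :: "'a topology" and A :: "('a, 'n::finite) chart set"
  assumes smooth_manifold: "smooth_manifold M A"
begin

abbreviation "V \<equiv> vector_fields A"
abbreviation "S \<equiv> smooth_funs A"

section \<open>Charts as homeomorphisms\<close>

lemma openin_chart: "c \<in> A \<Longrightarrow> openin M (fst c)"
  using smooth_manifold by (auto simp: smooth_manifold_def is_chart_def)

lemma open_chart_range: "c \<in> A \<Longrightarrow> open (snd c ` fst c)"
  using smooth_manifold by (simp add: smooth_manifold_def is_chart_def)

lemma homeomorphic_chart:
  "c \<in> A \<Longrightarrow> homeomorphic_map (subtopology M (fst c)) (top_of_set (snd c ` fst c)) (snd c)"
  using smooth_manifold by (auto simp: smooth_manifold_def is_chart_def)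

lemma topspace_chart: "c \<in> A \<Longrightarrow> topspace (subtopology M (fst c)) = fst c"
  using openin_subset[OF openin_chart] by (simp add: inf.absorb2)

lemma chart_inv_chart: "c \<in> A \<Longrightarrow> q \<in> fst c \<Longrightarrow> chart_inv c (snd c q) = q"
  using homeomorphic_imp_injective_map[OF homeomorphic_chart, of c]
  by (simp only: topspace_chart chart_inv_def inv_into_f_f)

lemma mem_of_chart_image:
  assumes "c \<in> A" "q \<in> fst c" "snd c q \<in> snd c ` (fst c \<inter> U)"
  shows "q \<in> U"
proof -
  obtain q' where "q' \<in> fst c" "q' \<in> U" "snd c q = snd c q'" using assms(3) by auto
  then show ?thesis using chart_inv_chart[OF assms(1)] assms(2) by metis
qed

lemma open_chart_image:
  assumes "c \<in> A" "openin M U"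
  shows "open (snd c ` (fst c \<inter> U))"
proof -
  have "openin (subtopology M (fst c)) (fst c \<inter> U)"
    using assms(2) by (metis inf_commute openin_subtopology_Int)
  then have "openin (top_of_set (snd c ` fst c)) (snd c ` (fst c \<inter> U))"
    using homeomorphic_imp_open_map[OF homeomorphic_chart[OF assms(1)]]
    by (simp add: open_map_def)
  moreover have "open (snd c ` fst c)"
    using smooth_manifold assms(1) by (auto simp: smooth_manifold_def is_chart_def)
  ultimately show ?thesis using openin_open_trans by blast
qed

lemma openin_chart_preimage:
  assumes "c \<in> A" "open T"
  shows "openin M {q \<in> fst c. snd c q \<in> T}"
proof -
  have "continuous_map (subtopology M (fst c)) (top_of_set (snd c ` fst c)) (snd c)"
    using homeomorphic_imp_continuous_map[OF homeomorphic_chart[OF assms(1)]] .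
  then have "continuous_map (subtopology M (fst c)) euclidean (snd c)"
    by (simp add: continuous_map_in_subtopology)
  then have "openin (subtopology M (fst c)) {q \<in> topspace (subtopology M (fst c)). snd c q \<in> T}"
    using assms(2) by (simp add: continuous_map_def)
  then have "openin (subtopology M (fst c)) {q \<in> fst c. snd c q \<in> T}"
    by (simp only: topspace_chart[OF assms(1)])
  then show ?thesis using openin_chart[OF assms(1)] openin_trans_full by blast
qed

section \<open>Coordinate changes and their Jacobians\<close>

lemma coord_change_chart:
  "c \<in> A \<Longrightarrow> q \<in> fst c \<Longrightarrow> coord_change c d (snd c q) = snd d q"
  by (simp add: coord_change_def chart_inv_chart)

lemma smooth_coord_change:
  "c \<in> A \<Longrightarrow> d \<in> A \<Longrightarrow> smooth_on (snd c ` (fst c \<inter> fst d)) (coord_change c d)"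
  using smooth_manifold by (auto simp: smooth_manifold_def)

lemma coord_change_has_derivative:
  assumes "c \<in> A" "d \<in> A" "q \<in> fst c" "q \<in> fst d"
  shows "(coord_change c d has_derivative tangent_change c d q) (at (snd c q))"
proof -
  have "(coord_change c d has_derivative frechet_derivative (coord_change c d) (at (snd c q)))
      (at (snd c q))"
    using smooth_on_has_derivative[OF smooth_coord_change[OF assms(1,2)]] assms(3,4) by simp
  then show ?thesis by (simp add: tangent_change_def[abs_def])
qed

lemma linear_tangent_change:
  assumes "c \<in> A" "d \<in> A" "q \<in> fst c" "q \<in> fst d"
  shows "linear (tangent_change c d q)"
  using coord_change_has_derivative[OF assms] by (rule has_derivative_linear)

text \<open>Chain rule for two successive coordinate changes. The composite is compared with the
  direct change only on the triple overlap \<open>?T\<close>, whose openness suffices for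
  derivatives.\<close>

lemma tangent_change_compose:
  assumes c: "c \<in> A" "d \<in> A" "e \<in> A" "q \<in> fst c" "q \<in> fst d" "q \<in> fst e"
  shows "tangent_change d e q (tangent_change c d q v) = tangent_change c e q v"
proof -
  let ?T = "snd c ` (fst c \<inter> (fst d \<inter> fst e))"
  have "(coord_change d e has_derivative tangent_change d e q) (at (coord_change c d (snd c q)))"
    using coord_change_has_derivative[of d e q] c by (simp add: coord_change_chart)
  from diff_chain_at[OF coord_change_has_derivative[of c d q] this]
  have "(coord_change d e \<circ> coord_change c d has_derivative
      tangent_change d e q \<circ> tangent_change c d q) (at (snd c q))" using c by simp
  then have "(coord_change c e has_derivative
      tangent_change d e q \<circ> tangent_change c d q) (at (snd c q))"
    by (rule has_derivative_transform_within_open[where s = ?T])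
      (use c in \<open>auto simp: coord_change_chart intro: open_chart_image openin_Int openin_chart\<close>)
  from has_derivative_unique[OF this coord_change_has_derivative[of c e q]] show ?thesis
    using c by (auto simp: fun_eq_iff)
qed

lemma tangent_change_same:
  assumes "c \<in> A" "q \<in> fst c"
  shows "tangent_change c c q v = v"
proof -
  have "((\<lambda>x. x) has_derivative (\<lambda>v. v)) (at (snd c q))" by (rule has_derivative_ident)
  then have "(coord_change c c has_derivative (\<lambda>v. v)) (at (snd c q))"
    by (rule has_derivative_transform_within_open[where s = "snd c ` fst c"])
      (use assms in \<open>auto simp: coord_change_chart open_chart_range\<close>)
  from has_derivative_unique[OF this coord_change_has_derivative[of c c q]] show ?thesis
    using assms by (metis)
qed

lemma chart_at:
  assumes "p \<in> topspace M"
  shows "chart_at A p \<in> A" "p \<in> fst (chart_at A p)"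
proof -
  have "\<exists>c. c \<in> A \<and> p \<in> fst c" using smooth_manifold assms by (auto simp: smooth_manifold_def)
  from someI_ex[OF this] show "chart_at A p \<in> A" "p \<in> fst (chart_at A p)"
    by (auto simp: chart_at_def)
qed

lemma in_topspace: "c \<in> A \<Longrightarrow> q \<in> fst c \<Longrightarrow> q \<in> topspace M"
  using openin_subset[OF openin_chart] by blast

lemmas chart_at' = chart_at[OF in_topspace]

text \<open>Undoes the jumping of the preferred charts: in one fixed chart c a field becomes an
  ordinary map between Euclidean spaces, to which calculus applies.\<close>

definition comps :: "('a, 'n) chart \<Rightarrow> ('a \<Rightarrow> real^'n) \<Rightarrow> 'a \<Rightarrow> real^'n" where
  "comps c X q = tangent_change (chart_at A q) c q (X q)"

lemma vector_fields_iff: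
  "X \<in> V U \<longleftrightarrow> (\<forall>c\<in>A. smooth_on (snd c ` (fst c \<inter> U)) (\<lambda>y. comps c X (chart_inv c y)))"
  by (simp add: vector_fields_def comps_def o_def)

lemma smooth_funs_iff:
  "f \<in> S U \<longleftrightarrow> (\<forall>c\<in>A. smooth_on (snd c ` (fst c \<inter> U)) (\<lambda>y. f (chart_inv c y)))"
  by (simp add: smooth_funs_def o_def)

lemma comps_at: "p \<in> topspace M \<Longrightarrow> comps (chart_at A p) X p = X p"
  by (simp add: comps_def tangent_change_same chart_at)

lemma comps_add:
  "c \<in> A \<Longrightarrow> q \<in> fst c \<Longrightarrow> comps c (\<lambda>q. X q + Y q) q = comps c X q + comps c Y q"
  by (simp add: comps_def linear_add[OF linear_tangent_change] chart_at')

lemma comps_scale: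
  "c \<in> A \<Longrightarrow> q \<in> fst c \<Longrightarrow> comps c (\<lambda>q. f q *\<^sub>R X q) q = f q *\<^sub>R comps c X q"
  by (simp add: comps_def linear_scale[OF linear_tangent_change] chart_at')

lemma smooth_funs_cong:
  assumes "openin M U" "f \<in> S U" "\<And>q. q \<in> U \<Longrightarrow> f q = g q"
  shows "g \<in> S U"
  unfolding smooth_funs_iff
proof
  fix c assume c: "c \<in> A"
  show "smooth_on (snd c ` (fst c \<inter> U)) (\<lambda>y. g (chart_inv c y))"
    by (rule smooth_on_cong[OF open_chart_image[OF c assms(1)], of "\<lambda>y. f (chart_inv c y)"])
      (use assms c in \<open>auto simp: smooth_funs_iff chart_inv_chart\<close>)
qed

lemma vector_fields_cong:
  assumes "openin M U" "X \<in> V U" "\<And>q. q \<in> U \<Longrightarrow> X q = Y q"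
  shows "Y \<in> V U"
  unfolding vector_fields_iff
proof
  fix c assume c: "c \<in> A"
  show "smooth_on (snd c ` (fst c \<inter> U)) (\<lambda>y. comps c Y (chart_inv c y))"
    by (rule smooth_on_cong[OF open_chart_image[OF c assms(1)], of "\<lambda>y. comps c X (chart_inv c y)"])
      (use assms c in \<open>auto simp: vector_fields_iff comps_def chart_inv_chart\<close>)
qed

lemma smooth_funs_subset: "f \<in> S U \<Longrightarrow> U' \<subseteq> U \<Longrightarrow> f \<in> S U'"
  unfolding smooth_funs_iff by (blast intro: smooth_on_subset)

lemma vector_fields_subset: "X \<in> V U \<Longrightarrow> U' \<subseteq> U \<Longrightarrow> X \<in> V U'"
  unfolding vector_fields_iff by (blast intro: smooth_on_subset)

lemma smooth_funs_const: "(\<lambda>q. a) \<in> S U"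
  by (simp add: smooth_funs_iff smooth_on_const)

lemma field_deriv_const: "field_deriv A X (\<lambda>q. a) p = 0"
  by (simp add: field_deriv_def o_def)

section \<open>Smooth functions, vector fields and derivations on an open set\<close>

context
  fixes U assumes U: "openin M U"
begin

lemma smooth_funs_mult: "f \<in> S U \<Longrightarrow> h \<in> S U \<Longrightarrow> (\<lambda>q. f q * h q) \<in> S U"
  by (simp add: smooth_funs_iff smooth_on_bilinear[OF _ bounded_bilinear_mult] open_chart_image U)

lemma smooth_funs_inverse:
  assumes "f \<in> S U" "\<forall>q\<in>U. f q \<noteq> 0"
  shows "(\<lambda>q. inverse (f q)) \<in> S U"
  unfolding smooth_funs_iff
proof
  fix c assume c: "c \<in> A"
  show "smooth_on (snd c ` (fst c \<inter> U)) (\<lambda>y. inverse (f (chart_inv c y)))"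
    by (intro smooth_on_inverse open_chart_image U c)
      (use assms c in \<open>auto simp: smooth_funs_iff chart_inv_chart\<close>)
qed

lemma vector_fields_add:
  assumes "X \<in> V U" "Y \<in> V U"
  shows "(\<lambda>q. X q + Y q) \<in> V U"
  unfolding vector_fields_iff
proof
  fix c assume c: "c \<in> A"
  have "smooth_on (snd c ` (fst c \<inter> U)) (\<lambda>y. comps c X (chart_inv c y) + comps c Y (chart_inv c y))"
    using assms c by (intro smooth_on_add open_chart_image U) (auto simp: vector_fields_iff)
  then show "smooth_on (snd c ` (fst c \<inter> U)) (\<lambda>y. comps c (\<lambda>q. X q + Y q) (chart_inv c y))"
    by (rule smooth_on_cong[OF open_chart_image[OF c U]])
      (use c in \<open>auto simp: chart_inv_chart comps_add\<close>)
qed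

lemma vector_fields_scale:
  assumes "f \<in> S U" "X \<in> V U"
  shows "(\<lambda>q. f q *\<^sub>R X q) \<in> V U"
  unfolding vector_fields_iff
proof
  fix c assume c: "c \<in> A"
  have "smooth_on (snd c ` (fst c \<inter> U)) (\<lambda>y. f (chart_inv c y) *\<^sub>R comps c X (chart_inv c y))"
    using assms c by (intro smooth_on_bilinear[OF _ bounded_bilinear_scaleR] open_chart_image U)
      (auto simp: vector_fields_iff smooth_funs_iff)
  then show "smooth_on (snd c ` (fst c \<inter> U)) (\<lambda>y. comps c (\<lambda>q. f q *\<^sub>R X q) (chart_inv c y))"
    by (rule smooth_on_cong[OF open_chart_image[OF c U]])
      (use c in \<open>auto simp: chart_inv_chart comps_scale\<close>)
qed

lemma vector_fields_cscale: "X \<in> V U \<Longrightarrow> (\<lambda>q. a *\<^sub>R X q) \<in> V U"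
  using vector_fields_scale[OF smooth_funs_const] .

lemma vector_fields_diff: "X \<in> V U \<Longrightarrow> Y \<in> V U \<Longrightarrow> (\<lambda>q. X q - Y q) \<in> V U"
  using vector_fields_add[OF _ vector_fields_cscale[of Y "- 1"], of X] by simp

lemma vector_fields_zero: "(\<lambda>q. 0) \<in> V U"
proof -
  have z: "comps c (\<lambda>q. 0) q = 0" if "c \<in> A" "q \<in> fst c" for c q
    using that by (simp add: comps_def linear_0[OF linear_tangent_change] chart_at')
  have "smooth_on (snd c ` (fst c \<inter> U)) (\<lambda>y. comps c (\<lambda>q. 0) (chart_inv c y))"
    if "c \<in> A" for c
    by (intro smooth_on_cong[OF _ smooth_on_const[of _ 0]] open_chart_image U that)
      (use that in \<open>auto simp: chart_inv_chart z\<close>)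
  then show ?thesis by (simp add: vector_fields_iff)
qed

lemma vector_fields_sum:
  "finite I \<Longrightarrow> (\<And>i. i \<in> I \<Longrightarrow> X i \<in> V U) \<Longrightarrow> (\<lambda>q. \<Sum>i\<in>I. X i q) \<in> V U"
  by (induction I rule: finite_induct) (auto simp: vector_fields_zero vector_fields_add)

lemma in_U: "p \<in> U \<Longrightarrow> p \<in> topspace M"
  using U openin_subset by blast

lemma smooth_fun_has_derivative:
  assumes "f \<in> S U" "c \<in> A" "p \<in> fst c" "p \<in> U"
  shows "((f \<circ> chart_inv c) has_derivative frechet_derivative (f \<circ> chart_inv c) (at (snd c p)))
    (at (snd c p))"
  by (rule smooth_on_has_derivative[of "snd c ` (fst c \<inter> U)"])
    (use assms in \<open>auto simp: smooth_funs_def\<close>)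

text \<open>\<open>field_deriv\<close> reads f in the preferred chart of each point, an expression
  that cannot itself be differentiated. By the chain rule any chart around p gives the same value,
  so a fixed chart can be used on a whole neighbourhood.\<close>

lemma field_deriv_chart:
  assumes f: "f \<in> S U" and d: "d \<in> A" "p \<in> fst d" and p: "p \<in> U"
  shows "field_deriv A X f p = frechet_derivative (f \<circ> chart_inv d) (at (snd d p)) (comps d X p)"
proof -
  let ?c = "chart_at A p"
  note c = chart_at[OF in_U[OF p]]
  let ?T = "snd ?c ` (fst ?c \<inter> (fst d \<inter> U))"
  have "((f \<circ> chart_inv d) has_derivative frechet_derivative (f \<circ> chart_inv d) (at (snd d p)))
    (at (coord_change ?c d (snd ?c p)))"
    using smooth_fun_has_derivative[OF f d p] by (simp add: coord_change_chart c)
  from diff_chain_at[OF coord_change_has_derivative[OF c(1) d(1) c(2) d(2)] this]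
  have "((f \<circ> chart_inv d) \<circ> coord_change ?c d has_derivative
      frechet_derivative (f \<circ> chart_inv d) (at (snd d p)) \<circ> tangent_change ?c d p) (at (snd ?c p))" .
  then have "(f \<circ> chart_inv ?c has_derivative
      frechet_derivative (f \<circ> chart_inv d) (at (snd d p)) \<circ> tangent_change ?c d p) (at (snd ?c p))"
    by (rule has_derivative_transform_within_open[where s = ?T])
      (use c d p in \<open>auto simp: coord_change_chart chart_inv_chart
        intro: open_chart_image openin_Int openin_chart U\<close>)
  then show ?thesis
    by (simp add: field_deriv_def frechet_derivative_eqI comps_def)
qed

lemma field_deriv_smooth:
  assumes "X \<in> V U" "f \<in> S U"
  shows "field_deriv A X f \<in> S U"
  unfolding smooth_funs_iff
proof
  fix c assume c: "c \<in> A"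
  have "smooth_on (snd c ` (fst c \<inter> U))
      (\<lambda>y. frechet_derivative (f \<circ> chart_inv c) (at y) (comps c X (chart_inv c y)))"
    using assms c by (intro smooth_on_frechet open_chart_image U)
      (auto simp: vector_fields_iff smooth_funs_def)
  then show "smooth_on (snd c ` (fst c \<inter> U)) (\<lambda>y. field_deriv A X f (chart_inv c y))"
    by (rule smooth_on_cong[OF open_chart_image[OF c U]])
      (use c assms in \<open>auto simp: chart_inv_chart field_deriv_chart\<close>)
qed

lemma field_deriv_cong:
  assumes "f \<in> S U" "\<And>q. q \<in> U \<Longrightarrow> f q = h q" "p \<in> U" "X p = Y p"
  shows "field_deriv A X f p = field_deriv A Y h p"
proof -
  let ?c = "chart_at A p"
  note c = chart_at[OF in_U[OF assms(3)]]
  have "frechet_derivative (h \<circ> chart_inv ?c) (at (snd ?c p)) =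
      frechet_derivative (f \<circ> chart_inv ?c) (at (snd ?c p))"
    by (rule frechet_derivative_cong_open[OF open_chart_image[OF c(1) U]])
      (use assms c in \<open>auto simp: smooth_funs_def chart_inv_chart\<close>)
  then show ?thesis by (simp add: field_deriv_def assms(4))
qed

lemma field_deriv_add:
  assumes "f \<in> S U" "h \<in> S U" "p \<in> U"
  shows "field_deriv A X (\<lambda>q. f q + h q) p = field_deriv A X f p + field_deriv A X h p"
proof -
  note c = chart_at[OF in_U[OF assms(3)]]
  show ?thesis
    using frechet_derivative_eqI[OF has_derivative_add[OF
      smooth_fun_has_derivative[OF assms(1) c assms(3)]
      smooth_fun_has_derivative[OF assms(2) c assms(3)]]]
    by (simp add: field_deriv_def o_def)
qed

lemma field_deriv_mult:
  assumes "f \<in> S U" "h \<in> S U" "p \<in> U"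
  shows "field_deriv A X (\<lambda>q. f q * h q) p =
    f p * field_deriv A X h p + field_deriv A X f p * h p"
proof -
  note c = chart_at[OF in_U[OF assms(3)]]
  show ?thesis
    using frechet_derivative_eqI[OF has_derivative_mult[OF
      smooth_fun_has_derivative[OF assms(1) c assms(3)]
      smooth_fun_has_derivative[OF assms(2) c assms(3)]]] c
    by (simp add: field_deriv_def o_def chart_inv_chart)
qed

lemma field_deriv_diff:
  assumes "f \<in> S U" "h \<in> S U" "p \<in> U"
  shows "field_deriv A X (\<lambda>q. f q - h q) p = field_deriv A X f p - field_deriv A X h p"
  using field_deriv_add[OF assms(1) smooth_funs_mult[OF smooth_funs_const[of "- 1"] assms(2)] assms(3)]
    field_deriv_mult[OF smooth_funs_const[of "- 1"] assms(2,3)]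
  by (simp add: field_deriv_const)

text \<open>The constant map \<open>\<lambda>_. v\<close> need not be a smooth field here.
  \<open>field_deriv\<close> looks at its value at p alone, so this is the differential of f at p as
  a function of the tangent vector.\<close>

lemma linear_field_deriv:
  assumes "f \<in> S U" "p \<in> U"
  shows "linear (\<lambda>v. field_deriv A (\<lambda>_. v) f p)"
  unfolding field_deriv_def using smooth_fun_has_derivative[OF assms(1) chart_at[OF in_U[OF assms(2)]] assms(2)]
  by (rule has_derivative_linear)

text \<open>The second derivatives of f cancel by symmetry; what remains is the differential of f on
  the classical coordinate bracket, the derivative of Y along X minus that of X along Y.\<close>

lemma field_deriv_comm_chart:
  assumes X: "X \<in> V U" and Y: "Y \<in> V U" and f: "f \<in> S U" and c: "c \<in> A" "p \<in> fst c" and p: "p \<in> U"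
  shows "field_deriv A X (field_deriv A Y f) p - field_deriv A Y (field_deriv A X f) p =
    frechet_derivative (f \<circ> chart_inv c) (at (snd c p))
      (frechet_derivative (\<lambda>y. comps c Y (chart_inv c y)) (at (snd c p)) (comps c X p) -
       frechet_derivative (\<lambda>y. comps c X (chart_inv c y)) (at (snd c p)) (comps c Y p))"
proof -
  let ?T = "snd c ` (fst c \<inter> U)" and ?F = "f \<circ> chart_inv c" and ?x = "snd c p"
  have T: "open ?T" by (rule open_chart_image[OF c(1) U])
  have x: "?x \<in> ?T" using c p by simp
  have F: "smooth_on ?T ?F" using f c by (simp add: smooth_funs_def)
  have cX: "smooth_on ?T (\<lambda>y. comps c X (chart_inv c y))" if "X \<in> V U" for X
    using that c by (simp add: vector_fields_iff)
  have *: "field_deriv A X (field_deriv A Y f) p =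
      frechet_derivative (\<lambda>y. frechet_derivative ?F (at y) (comps c Y p)) (at ?x) (comps c X p) +
      frechet_derivative ?F (at ?x)
        (frechet_derivative (\<lambda>y. comps c Y (chart_inv c y)) (at ?x) (comps c X p))"
    if X: "X \<in> V U" and Y: "Y \<in> V U" for X Y
  proof -
    have "field_deriv A X (field_deriv A Y f) p =
        frechet_derivative (field_deriv A Y f \<circ> chart_inv c) (at ?x) (comps c X p)"
      by (rule field_deriv_chart[OF field_deriv_smooth[OF Y f] c p])
    also have "frechet_derivative (field_deriv A Y f \<circ> chart_inv c) (at ?x) =
        frechet_derivative (\<lambda>y. frechet_derivative ?F (at y) (comps c Y (chart_inv c y))) (at ?x)"
      by (rule frechet_derivative_cong_open[OF T x smooth_on_frechet[OF T F cX[OF Y]]])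
        (auto simp: chart_inv_chart c field_deriv_chart[OF f c(1)])
    finally show ?thesis
      using frechet_derivative_apply[OF T F cX[OF Y] x] c by (simp add: chart_inv_chart)
  qed
  have lin: "linear (frechet_derivative ?F (at ?x))"
    using smooth_fun_has_derivative[OF f c p] by (rule has_derivative_linear)
  show ?thesis
    unfolding *[OF X Y] *[OF Y X] linear_diff[OF lin]
    using symmetric_second_derivative[OF T F x, of "comps c X p" "comps c Y p"] by simp
qed

end

section \<open>Coordinate functions, Lie brackets and coordinate frames\<close>

lemma coord_fun_smooth:
  assumes "c \<in> A"
  shows "(\<lambda>q. snd c q $ k) \<in> S (fst c)"
  unfolding smooth_funs_iff
proof
  fix d assume d: "d \<in> A"
  have "smooth_on (snd d ` (fst d \<inter> fst c)) (\<lambda>y. coord_change d c y $ k)"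
    by (rule smooth_on_linear[OF open_chart_image[OF d openin_chart[OF assms]]
          bounded_linear_vec_nth smooth_coord_change[OF d assms]])
  then show "smooth_on (snd d ` (fst d \<inter> fst c)) (\<lambda>y. snd c (chart_inv d y) $ k)"
    by (simp add: coord_change_def)
qed

lemma frechet_derivative_coord_fun:
  assumes "c \<in> A" "p \<in> fst c"
  shows "frechet_derivative ((\<lambda>q. snd c q $ k) \<circ> chart_inv c) (at (snd c p)) v = v $ k"
proof -
  have "((\<lambda>y. y $ k) has_derivative (\<lambda>y. y $ k)) (at (snd c p))"
    by (intro bounded_linear.has_derivative[OF bounded_linear_vec_nth] has_derivative_ident)
  then have "((\<lambda>q. snd c q $ k) \<circ> chart_inv c has_derivative (\<lambda>y. y $ k)) (at (snd c p))"
    by (rule has_derivative_transform_within_open[where s = "snd c ` fst c"])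
      (use assms in \<open>auto simp: chart_inv_chart open_chart_range\<close>)
  then show ?thesis by (simp add: frechet_derivative_eqI)
qed

lemma field_deriv_coord_fun:
  assumes "c \<in> A" "p \<in> fst c"
  shows "field_deriv A X (\<lambda>q. snd c q $ k) p = comps c X p $ k"
  using field_deriv_chart[OF openin_chart[OF assms(1)] coord_fun_smooth[OF assms(1)] assms assms(2)]
    frechet_derivative_coord_fun[OF assms] by simp

lemma comps_smooth:
  assumes "openin M U" "c \<in> A" "U \<subseteq> fst c" "X \<in> V U"
  shows "(\<lambda>q. comps c X q $ k) \<in> S U"
proof (rule smooth_funs_cong[OF assms(1)])
  show "field_deriv A X (\<lambda>q. snd c q $ k) \<in> S U"
    by (rule field_deriv_smooth[OF assms(1,4) smooth_funs_subset[OF coord_fun_smooth]])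
      (use assms openin_chart in auto)
qed (use assms in \<open>auto simp: field_deriv_coord_fun\<close>)

text \<open>By definition the bracket is tested on the coordinate functions of the chart at p only.
  They determine its components, and then every smooth f sees the same vector
  \<open>?B\<close>.\<close>

lemma field_deriv_lie_bracket:
  assumes U: "openin M U" and X: "X \<in> V U" and Y: "Y \<in> V U" and f: "f \<in> S U" and p: "p \<in> U"
  shows "field_deriv A (lie_bracket A X Y) f p =
    field_deriv A X (field_deriv A Y f) p - field_deriv A Y (field_deriv A X f) p"
proof -
  let ?c = "chart_at A p"
  note c = chart_at[OF in_U[OF U p]]
  let ?U = "U \<inter> fst ?c"
  have U': "openin M ?U" using U openin_chart[OF c(1)] by blast
  let ?B = "frechet_derivative (\<lambda>y. comps ?c Y (chart_inv ?c y)) (at (snd ?c p)) (comps ?c X p) -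
       frechet_derivative (\<lambda>y. comps ?c X (chart_inv ?c y)) (at (snd ?c p)) (comps ?c Y p)"
  have "lie_bracket A X Y p $ k = ?B $ k" for k
  proof -
    have s: "(\<lambda>q. snd ?c q $ k) \<in> S ?U"
      using coord_fun_smooth[OF c(1)] U' smooth_funs_subset openin_chart c by blast
    have "X \<in> V ?U" "Y \<in> V ?U" using X Y vector_fields_subset by blast+
    from field_deriv_comm_chart[OF U' this s c] p c show ?thesis
      by (simp add: lie_bracket_def Let_def frechet_derivative_coord_fun)
  qed
  then have "lie_bracket A X Y p = ?B" by (simp add: vec_eq_iff)
  then have "field_deriv A (lie_bracket A X Y) f p =
      frechet_derivative (f \<circ> chart_inv ?c) (at (snd ?c p)) ?B"
    by (simp add: field_deriv_def)
  then show ?thesis using field_deriv_comm_chart[OF U X Y f c p] by simp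
qed

lemma comps_vec_extension:
  assumes "p \<in> topspace M" "q \<in> fst (chart_at A p)" "d \<in> A" "q \<in> fst d"
  shows "comps d (vec_extension A p v) q = tangent_change (chart_at A p) d q v"
  using assms by (simp add: comps_def vec_extension_def tangent_change_compose chart_at chart_at')

lemma vec_extension_vector_field:
  assumes "p \<in> topspace M"
  shows "vec_extension A p v \<in> V (fst (chart_at A p))"
  unfolding vector_fields_iff
proof
  fix d assume d: "d \<in> A"
  let ?c = "chart_at A p"
  note c = chart_at[OF assms]
  let ?D = "\<lambda>z. frechet_derivative (coord_change ?c d) (at z) v"
  have T: "open (snd d ` (fst d \<inter> fst ?c))"
    by (intro open_chart_image d openin_chart c)
  have T': "open (snd ?c ` (fst ?c \<inter> fst d))"
    by (intro open_chart_image d openin_chart c)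
  have "smooth_on (snd d ` (fst d \<inter> fst ?c)) (?D \<circ> coord_change d ?c)"
    by (rule smooth_on_compose[OF T smooth_on_frechet[OF T' smooth_coord_change smooth_on_const]
        smooth_coord_change])
      (use c d in \<open>auto simp: coord_change_chart\<close>)
  then show "smooth_on (snd d ` (fst d \<inter> fst ?c)) (\<lambda>y. comps d (vec_extension A p v) (chart_inv d y))"
    by (rule smooth_on_cong[OF T])
      (use c d assms in \<open>auto simp: coord_change_chart comps_vec_extension chart_inv_chart
        tangent_change_def\<close>)
qed

lemma vec_extension_at: "p \<in> topspace M \<Longrightarrow> vec_extension A p v p = v"
  by (simp add: vec_extension_def tangent_change_same chart_at)

lemma vector_field_expand:
  assumes p: "p \<in> topspace M" and q: "q \<in> fst (chart_at A p)"
  shows "X q = (\<Sum>i\<in>UNIV. (comps (chart_at A p) X q $ i) *\<^sub>R vec_extension A p (axis i 1) q)"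
proof -
  let ?c = "chart_at A p" and ?d = "chart_at A q"
  note c = chart_at[OF p] and d = chart_at'[OF chart_at(1)[OF p] q]
  have lin: "linear (tangent_change ?c ?d q)" by (rule linear_tangent_change) (use c d q in auto)
  have "(\<Sum>i\<in>UNIV. (comps ?c X q $ i) *\<^sub>R vec_extension A p (axis i 1) q) =
      tangent_change ?c ?d q (\<Sum>i\<in>UNIV. (comps ?c X q $ i) *\<^sub>R axis i 1)"
    by (simp add: vec_extension_def linear_sum[OF lin] linear_scale[OF lin])
  also have "(\<Sum>i\<in>UNIV. (comps ?c X q $ i) *\<^sub>R axis i 1) = comps ?c X q"
    using basis_expansion[of "comps ?c X q"] by (simp add: scalar_mult_eq_scaleR)
  finally show ?thesis
    using c d q by (simp add: comps_def tangent_change_compose tangent_change_same)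
qed

text \<open>A map that is linear over the smooth functions is determined by the value of its argument
  at the point, because its argument can be expanded in the coordinate frame.\<close>

lemma tensorial_eq:
  fixes T :: "('a \<Rightarrow> real^'n) \<Rightarrow> 'b::real_vector"
  assumes U: "openin M U" and p: "p \<in> U"
    and XY: "X \<in> V U" "Y \<in> V U" "X p = Y p"
    and cong: "\<And>W X Y. openin M W \<Longrightarrow> p \<in> W \<Longrightarrow> W \<subseteq> U \<Longrightarrow> X \<in> V W \<Longrightarrow> Y \<in> V W \<Longrightarrow>
      (\<forall>q\<in>W. X q = Y q) \<Longrightarrow> T X = T Y"
    and add: "\<And>W X Y. openin M W \<Longrightarrow> p \<in> W \<Longrightarrow> W \<subseteq> U \<Longrightarrow> X \<in> V W \<Longrightarrow> Y \<in> V W \<Longrightarrow>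
      T (\<lambda>q. X q + Y q) = T X + T Y"
    and scale: "\<And>W f X. openin M W \<Longrightarrow> p \<in> W \<Longrightarrow> W \<subseteq> U \<Longrightarrow> f \<in> S W \<Longrightarrow> X \<in> V W \<Longrightarrow>
      T (\<lambda>q. f q *\<^sub>R X q) = f p *\<^sub>R T X"
  shows "T X = T Y"
proof -
  let ?c = "chart_at A p"
  note c = chart_at[OF in_U[OF U p]]
  \<comment> \<open>The coordinate frame exists on the chart domain only, which need not contain U.
    Hence the rules for T are assumed on every open neighbourhood of p inside U.\<close>
  let ?W = "U \<inter> fst ?c" and ?E = "\<lambda>i. vec_extension A p (axis i 1)"
  have W: "openin M ?W" "p \<in> ?W" "?W \<subseteq> U" using U p openin_chart[OF c(1)] c by auto
  have E: "?E i \<in> V ?W" for i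
    using vec_extension_vector_field[OF in_U[OF U p]] vector_fields_subset by blast
  have *: "T X = (\<Sum>i\<in>UNIV. (X p $ i) *\<^sub>R T (?E i))" if X: "X \<in> V U" for X
  proof -
    let ?f = "\<lambda>i q. comps ?c X q $ i"
    have XW: "X \<in> V ?W" using X vector_fields_subset by blast
    have f: "?f i \<in> S ?W" for i
      by (rule comps_smooth[OF W(1) c(1) _ XW]) auto
    have fE: "(\<lambda>q. ?f i q *\<^sub>R ?E i q) \<in> V ?W" for i
      by (rule vector_fields_scale[OF W(1) f E])
    \<comment> \<open>Scaling by the zero function; which frame field is scaled is immaterial, hence
      the index \<open>undefined\<close>.\<close>
    have T0: "T (\<lambda>q. 0) = 0"
      using scale[OF W smooth_funs_const[of 0] E, of undefined] by simp
    have sum: "T (\<lambda>q. \<Sum>i\<in>I. ?f i q *\<^sub>R ?E i q) = (\<Sum>i\<in>I. ?f i p *\<^sub>R T (?E i))" if "finite I" for I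
      using that
    proof (induction I rule: finite_induct)
      case (insert i I)
      then show ?case
        using add[OF W fE vector_fields_sum[OF W(1) insert(1) fE], of i] scale[OF W f E, of i i]
        by simp
    qed (simp add: T0)
    have "T X = T (\<lambda>q. \<Sum>i\<in>UNIV. ?f i q *\<^sub>R ?E i q)"
      by (rule cong[OF W XW vector_fields_sum[OF W(1) _ fE]])
        (use vector_field_expand[OF in_U[OF U p]] in auto)
    also have "\<dots> = (\<Sum>i\<in>UNIV. (X p $ i) *\<^sub>R T (?E i))"
      by (simp add: sum comps_at in_U[OF U p])
    finally show ?thesis .
  qed
  show ?thesis using *[OF XY(1)] *[OF XY(2)] XY(3) by simp
qed

section \<open>Nonvanishing sets, and functions with vanishing differential\<close>

lemma openin_nonzero:
  assumes U: "openin M U" and h: "h \<in> S U"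
  shows "openin M {q \<in> U. h q \<noteq> 0}"
proof (subst openin_subopen, intro ballI)
  fix p assume p: "p \<in> {q \<in> U. h q \<noteq> 0}"
  then have pU: "p \<in> U" by simp
  let ?c = "chart_at A p"
  note c = chart_at[OF in_U[OF U pU]]
  let ?T = "snd ?c ` (fst ?c \<inter> U)" and ?h = "\<lambda>y. h (chart_inv ?c y)"
  have T: "open ?T" by (rule open_chart_image[OF c(1) U])
  have "continuous_on ?T ?h"
    using h c smooth_on_continuous by (auto simp: smooth_funs_iff)
  then have "open (?T \<inter> ?h -` (- {0}))"
    by (rule continuous_open_preimage[OF _ T]) auto
  from openin_chart_preimage[OF c(1) this]
  have 1: "openin M {q \<in> fst ?c. snd ?c q \<in> ?T \<inter> ?h -` (- {0})}" .
  have 2: "{q \<in> fst ?c. snd ?c q \<in> ?T \<inter> ?h -` (- {0})} \<subseteq> {q \<in> U. h q \<noteq> 0}"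
  proof
    fix q assume q: "q \<in> {q \<in> fst ?c. snd ?c q \<in> ?T \<inter> ?h -` (- {0})}"
    then have q': "q \<in> fst ?c" "snd ?c q \<in> ?T" "?h (snd ?c q) \<noteq> 0" by simp_all
    then show "q \<in> {q \<in> U. h q \<noteq> 0}"
      using mem_of_chart_image[OF c(1) q'(1,2)] c(1) by (simp add: chart_inv_chart)
  qed
  have "p \<in> {q \<in> fst ?c. snd ?c q \<in> ?T \<inter> ?h -` (- {0})}"
    using p c by (auto simp: chart_inv_chart)
  with 1 2 show "\<exists>T. openin M T \<and> p \<in> T \<and> T \<subseteq> {q \<in> U. h q \<noteq> 0}" by blast
qed

lemma locally_constant:
  assumes U: "openin M U" and h: "h \<in> S U" and p: "p \<in> U"
    and zero: "\<And>q v. q \<in> U \<Longrightarrow> field_deriv A (\<lambda>_. v) h q = 0"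
  obtains W where "openin M W" "p \<in> W" "W \<subseteq> U" "\<And>q. q \<in> W \<Longrightarrow> h q = h p"
proof -
  let ?c = "chart_at A p"
  note c = chart_at[OF in_U[OF U p]]
  let ?T = "snd ?c ` (fst ?c \<inter> U)" and ?h = "h \<circ> chart_inv ?c"
  have T: "open ?T" by (rule open_chart_image[OF c(1) U])
  have D: "(?h has_derivative (\<lambda>v. 0)) (at y)" if "y \<in> ?T" for y
  proof -
    from that obtain q where q: "q \<in> fst ?c" "q \<in> U" "y = snd ?c q" by auto
    note d = chart_at[OF in_U[OF U q(2)]]
    have "frechet_derivative ?h (at y) w = 0" for w
    proof -
      \<comment> \<open>The direction w belongs to the chart at p, while the hypothesis reads its
        vector in the preferred chart at q; the Jacobian translates between them.\<close>
      have "0 = field_deriv A (\<lambda>_. tangent_change ?c (chart_at A q) q w) h q"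
        using zero[OF q(2)] by simp
      also have "\<dots> = frechet_derivative ?h (at y) w"
        using field_deriv_chart[OF U h c(1) q(1,2)] q c d
        by (simp add: comps_def tangent_change_compose tangent_change_same)
      finally show ?thesis by simp
    qed
    then have "frechet_derivative ?h (at y) = (\<lambda>v. 0)" by auto
    with smooth_fun_has_derivative[OF U h c(1) q(1,2)] q show ?thesis by simp
  qed
  have "snd ?c p \<in> ?T" using c p by simp
  then obtain r where r: "r > 0" "ball (snd ?c p) r \<subseteq> ?T" using T openE by blast
  let ?W = "{q \<in> fst ?c. snd ?c q \<in> ball (snd ?c p) r}"
  have "\<exists>k. \<forall>y\<in>ball (snd ?c p) r. ?h y = k"
    by (rule has_derivative_zero_constant[OF convex_ball])
      (use D r(2) has_derivative_at_withinI in blast)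
  then obtain k where k: "\<And>y. y \<in> ball (snd ?c p) r \<Longrightarrow> ?h y = k" by blast
  show ?thesis
  proof (rule that[of ?W])
    show "openin M ?W" by (rule openin_chart_preimage[OF c(1) open_ball])
    show "p \<in> ?W" using c r by simp
    show "?W \<subseteq> U"
      using r(2) mem_of_chart_image[OF c(1)] by blast
    show "h q = h p" if "q \<in> ?W" for q
      using k[of "snd ?c q"] k[of "snd ?c p"] that c r by (simp add: chart_inv_chart)
  qed
qed

end

section \<open>Curvature of the Levi-Civita connection\<close>

locale levi_civita_mfd = smooth_mfd M A
  for M :: "'a topology" and A :: "('a, 'n::finite) chart set" +
  fixes g :: "'a \<Rightarrow> real^'n \<Rightarrow> real^'n \<Rightarrow> real"
    and nabla :: "('a \<Rightarrow> real^'n) \<Rightarrow> ('a \<Rightarrow> real^'n) \<Rightarrow> 'a \<Rightarrow> real^'n"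
  assumes metric: "pseudo_riemannian_metric M A g"
    and levi_civita: "levi_civita M A g nabla"
begin

abbreviation "R \<equiv> curvature A nabla"

lemma connection: "affine_connection M A nabla"
  using levi_civita by (simp add: levi_civita_def)

lemma bilinear_metric: "p \<in> topspace M \<Longrightarrow> bilinear (g p)"
  and metric_commute: "p \<in> topspace M \<Longrightarrow> g p u v = g p v u"
  and metric_nondegenerate: "p \<in> topspace M \<Longrightarrow> (\<And>v. g p u v = 0) \<Longrightarrow> u = 0"
  using metric by (auto simp: pseudo_riemannian_metric_def)

lemmas metric_simps = bilinear_ladd[OF bilinear_metric] bilinear_radd[OF bilinear_metric]
  bilinear_lsub[OF bilinear_metric] bilinear_rsub[OF bilinear_metric]
  bilinear_lmul[OF bilinear_metric] bilinear_rmul[OF bilinear_metric]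
  bilinear_lneg[OF bilinear_metric] bilinear_rneg[OF bilinear_metric]
  bilinear_lzero[OF bilinear_metric] bilinear_rzero[OF bilinear_metric]

section \<open>Connection, bracket and curvature of fields on an open set\<close>

context
  fixes U assumes U: "openin M U"
begin

lemma metric_smooth: "X \<in> V U \<Longrightarrow> Y \<in> V U \<Longrightarrow> (\<lambda>q. g q (X q) (Y q)) \<in> S U"
  using metric U by (simp add: pseudo_riemannian_metric_def)

lemmas connection_on =
  connection[unfolded affine_connection_def, THEN spec, THEN mp, OF U]

lemma nabla_vector_field: "X \<in> V U \<Longrightarrow> Y \<in> V U \<Longrightarrow> nabla X Y \<in> V U"
  by (rule connection_on[THEN conjunct1, rule_format])

lemma nabla_cong:
  assumes "X \<in> V U" "Y \<in> V U" "\<And>q. q \<in> U \<Longrightarrow> X q = X' q" "\<And>q. q \<in> U \<Longrightarrow> Y q = Y' q" "p \<in> U"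
  shows "nabla X Y p = nabla X' Y' p"
proof -
  have "X' \<in> V U" "Y' \<in> V U"
    using assms vector_fields_cong[OF U] by blast+
  then show ?thesis
    by (intro connection_on[THEN conjunct2, THEN conjunct1, rule_format]) (use assms in auto)
qed

lemma nabla_add_left:
  "X \<in> V U \<Longrightarrow> X' \<in> V U \<Longrightarrow> Y \<in> V U \<Longrightarrow> p \<in> U \<Longrightarrow>
   nabla (\<lambda>q. X q + X' q) Y p = nabla X Y p + nabla X' Y p"
  by (rule connection_on[THEN conjunct2, THEN conjunct2, THEN conjunct1, rule_format])

lemma nabla_scale_left:
  "f \<in> S U \<Longrightarrow> X \<in> V U \<Longrightarrow> Y \<in> V U \<Longrightarrow> p \<in> U \<Longrightarrow>
   nabla (\<lambda>q. f q *\<^sub>R X q) Y p = f p *\<^sub>R nabla X Y p"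
  by (rule connection_on[THEN conjunct2, THEN conjunct2, THEN conjunct2, THEN conjunct1, rule_format])

lemma nabla_add_right:
  "X \<in> V U \<Longrightarrow> Y \<in> V U \<Longrightarrow> Y' \<in> V U \<Longrightarrow> p \<in> U \<Longrightarrow>
   nabla X (\<lambda>q. Y q + Y' q) p = nabla X Y p + nabla X Y' p"
  by (rule connection_on[THEN conjunct2, THEN conjunct2, THEN conjunct2, THEN conjunct2, THEN conjunct1, rule_format])

lemma nabla_scale_right:
  "f \<in> S U \<Longrightarrow> X \<in> V U \<Longrightarrow> Y \<in> V U \<Longrightarrow> p \<in> U \<Longrightarrow>
   nabla X (\<lambda>q. f q *\<^sub>R Y q) p = field_deriv A X f p *\<^sub>R Y p + f p *\<^sub>R nabla X Y p"
  by (rule connection_on[THEN conjunct2, THEN conjunct2, THEN conjunct2, THEN conjunct2, THEN conjunct2, rule_format])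

lemma torsion_free:
  "X \<in> V U \<Longrightarrow> Y \<in> V U \<Longrightarrow> p \<in> U \<Longrightarrow> lie_bracket A X Y p = nabla X Y p - nabla Y X p"
  using levi_civita U by (simp add: levi_civita_def)

lemma metric_compatible:
  "X \<in> V U \<Longrightarrow> Y \<in> V U \<Longrightarrow> Z \<in> V U \<Longrightarrow> p \<in> U \<Longrightarrow>
   field_deriv A X (\<lambda>q. g q (Y q) (Z q)) p = g p (nabla X Y p) (Z p) + g p (Y p) (nabla X Z p)"
  using levi_civita U by (simp add: levi_civita_def)

lemma nabla_diff_left:
  assumes "X \<in> V U" "X' \<in> V U" "Y \<in> V U" "p \<in> U"
  shows "nabla (\<lambda>q. X q - X' q) Y p = nabla X Y p - nabla X' Y p"
  using nabla_add_left[of X "\<lambda>q. - 1 *\<^sub>R X' q" Y p] nabla_scale_left[OF smooth_funs_const, of X' Y p "- 1"]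
    vector_fields_cscale[OF U, of X' "- 1"] assms by simp

lemma nabla_diff_right:
  assumes "X \<in> V U" "Y \<in> V U" "Y' \<in> V U" "p \<in> U"
  shows "nabla X (\<lambda>q. Y q - Y' q) p = nabla X Y p - nabla X Y' p"
  using nabla_add_right[of X Y "\<lambda>q. - 1 *\<^sub>R Y' q" p]
    nabla_scale_right[OF smooth_funs_const, of X Y' p "- 1"]
    vector_fields_cscale[OF U, of Y' "- 1"] assms by (simp add: field_deriv_const)

text \<open>Torsion-freeness replaces a computation in coordinates: on U the bracket is a difference
  of two covariant derivatives, and the rules for brackets below follow from those for
  \<open>nabla\<close> in the same way.\<close>

lemma lie_bracket_vector_field:
  assumes "X \<in> V U" "Y \<in> V U"
  shows "lie_bracket A X Y \<in> V U"
  by (rule vector_fields_cong[OF U vector_fields_diff[OF U nabla_vector_field[OF assms]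
    nabla_vector_field[OF assms(2,1)]]]) (simp add: torsion_free assms)

lemma lie_bracket_cong:
  assumes "X \<in> V U" "Y \<in> V U" "\<And>q. q \<in> U \<Longrightarrow> X q = X' q" "\<And>q. q \<in> U \<Longrightarrow> Y q = Y' q" "p \<in> U"
  shows "lie_bracket A X Y p = lie_bracket A X' Y' p"
proof -
  have "X' \<in> V U" "Y' \<in> V U"
    using assms vector_fields_cong[OF U] by blast+
  then show ?thesis
    using assms nabla_cong[of X Y X' Y'] nabla_cong[of Y X Y' X'] by (simp add: torsion_free)
qed

lemma lie_bracket_skew:
  "X \<in> V U \<Longrightarrow> Y \<in> V U \<Longrightarrow> p \<in> U \<Longrightarrow> lie_bracket A X Y p = - lie_bracket A Y X p"
  by (simp add: torsion_free)

lemma lie_bracket_add_left: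
  "X \<in> V U \<Longrightarrow> X' \<in> V U \<Longrightarrow> Y \<in> V U \<Longrightarrow> p \<in> U \<Longrightarrow>
   lie_bracket A (\<lambda>q. X q + X' q) Y p = lie_bracket A X Y p + lie_bracket A X' Y p"
  by (simp add: torsion_free nabla_add_left nabla_add_right vector_fields_add[OF U])

lemma lie_bracket_scale_left:
  "f \<in> S U \<Longrightarrow> X \<in> V U \<Longrightarrow> Y \<in> V U \<Longrightarrow> p \<in> U \<Longrightarrow>
   lie_bracket A (\<lambda>q. f q *\<^sub>R X q) Y p = f p *\<^sub>R lie_bracket A X Y p - field_deriv A Y f p *\<^sub>R X p"
  by (simp add: torsion_free nabla_scale_left nabla_scale_right vector_fields_scale[OF U]
      scaleR_diff_right)

lemma curvature_vector_field:
  assumes "X \<in> V U" "Y \<in> V U" "Z \<in> V U"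
  shows "R X Y Z \<in> V U"
proof (rule vector_fields_cong[OF U])
  show "(\<lambda>q. (nabla X (nabla Y Z) q - nabla Y (nabla X Z) q) - nabla (lie_bracket A X Y) Z q) \<in> V U"
    by (intro vector_fields_diff[OF U] nabla_vector_field lie_bracket_vector_field assms)
qed (simp add: curvature_def)

lemma curvature_cong:
  assumes X: "X \<in> V U" "Y \<in> V U" "Z \<in> V U"
    and eq: "\<And>q. q \<in> U \<Longrightarrow> X q = X' q" "\<And>q. q \<in> U \<Longrightarrow> Y q = Y' q" "\<And>q. q \<in> U \<Longrightarrow> Z q = Z' q"
    and p: "p \<in> U"
  shows "R X Y Z p = R X' Y' Z' p"
proof -
  have "nabla X (nabla Y Z) p = nabla X' (nabla Y' Z') p"
    by (intro nabla_cong nabla_vector_field X eq p)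
  moreover have "nabla Y (nabla X Z) p = nabla Y' (nabla X' Z') p"
    by (intro nabla_cong nabla_vector_field X eq p)
  moreover have "nabla (lie_bracket A X Y) Z p = nabla (lie_bracket A X' Y') Z' p"
    by (intro nabla_cong lie_bracket_vector_field lie_bracket_cong X eq p)
  ultimately show ?thesis by (simp add: curvature_def)
qed

lemma curvature_skew:
  assumes X: "X \<in> V U" "Y \<in> V U" "Z \<in> V U" and p: "p \<in> U"
  shows "R X Y Z p = - R Y X Z p"
proof -
  have "nabla (lie_bracket A X Y) Z p = nabla (\<lambda>q. - 1 *\<^sub>R lie_bracket A Y X q) Z p"
    by (intro nabla_cong lie_bracket_vector_field X p) (simp_all add: lie_bracket_skew[of X Y] X)
  also have "\<dots> = - nabla (lie_bracket A Y X) Z p"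
    using nabla_scale_left[OF smooth_funs_const lie_bracket_vector_field, of Y X Z p "- 1"] X p
    by simp
  finally show ?thesis by (simp add: curvature_def)
qed

lemma curvature_add_1:
  assumes X: "X \<in> V U" "X' \<in> V U" "Y \<in> V U" "Z \<in> V U" and p: "p \<in> U"
  shows "R (\<lambda>q. X q + X' q) Y Z p = R X Y Z p + R X' Y Z p"
proof -
  note V = X nabla_vector_field lie_bracket_vector_field
  have "nabla Y (nabla (\<lambda>q. X q + X' q) Z) p = nabla Y (\<lambda>q. nabla X Z q + nabla X' Z q) p"
    by (rule nabla_cong) (simp_all add: V vector_fields_add[OF U] nabla_add_left p)
  moreover have "nabla (lie_bracket A (\<lambda>q. X q + X' q) Y) Z p =
      nabla (\<lambda>q. lie_bracket A X Y q + lie_bracket A X' Y q) Z p"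
    by (rule nabla_cong) (simp_all add: V vector_fields_add[OF U] lie_bracket_add_left p)
  ultimately show ?thesis
    by (simp add: curvature_def nabla_add_left nabla_add_right V p)
qed

text \<open>The derivative Yf enters twice, from the product rule in
  \<open>nabla Y (nabla (f X) Z)\<close> and from the bracket [fX, Y], and the two contributions
  cancel.\<close>

lemma curvature_scale_1:
  assumes f: "f \<in> S U" and X: "X \<in> V U" "Y \<in> V U" "Z \<in> V U" and p: "p \<in> U"
  shows "R (\<lambda>q. f q *\<^sub>R X q) Y Z p = f p *\<^sub>R R X Y Z p"
proof -
  note V = f X nabla_vector_field lie_bracket_vector_field vector_fields_scale[OF U]
    field_deriv_smooth[OF U]
  have "nabla Y (nabla (\<lambda>q. f q *\<^sub>R X q) Z) p = nabla Y (\<lambda>q. f q *\<^sub>R nabla X Z q) p"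
    by (rule nabla_cong) (simp_all add: V nabla_scale_left p)
  moreover have "nabla (lie_bracket A (\<lambda>q. f q *\<^sub>R X q) Y) Z p =
      nabla (\<lambda>q. f q *\<^sub>R lie_bracket A X Y q - field_deriv A Y f q *\<^sub>R X q) Z p"
    by (rule nabla_cong) (simp_all add: V lie_bracket_scale_left p)
  ultimately show ?thesis
    by (simp add: curvature_def nabla_diff_left nabla_scale_left nabla_scale_right V p
        algebra_simps)
qed

lemma curvature_add_3:
  assumes X: "X \<in> V U" "Y \<in> V U" "Z \<in> V U" "Z' \<in> V U" and p: "p \<in> U"
  shows "R X Y (\<lambda>q. Z q + Z' q) p = R X Y Z p + R X Y Z' p"
proof -
  note V = X nabla_vector_field lie_bracket_vector_field
  have "nabla X (nabla Y (\<lambda>q. Z q + Z' q)) p = nabla X (\<lambda>q. nabla Y Z q + nabla Y Z' q) p"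
    if "X \<in> V U" "Y \<in> V U" for X Y
    by (rule nabla_cong) (simp_all add: V vector_fields_add[OF U] nabla_add_right p that)
  then show ?thesis
    by (simp add: curvature_def nabla_add_right V p)
qed

text \<open>Mixed first-order terms are symmetric in X and Y and cancel; the terms with second
  derivatives of f add up to (XYf - YXf - [X, Y]f)Z = 0.\<close>

lemma curvature_scale_3:
  assumes f: "f \<in> S U" and X: "X \<in> V U" "Y \<in> V U" "Z \<in> V U" and p: "p \<in> U"
  shows "R X Y (\<lambda>q. f q *\<^sub>R Z q) p = f p *\<^sub>R R X Y Z p"
proof -
  note V = f X nabla_vector_field lie_bracket_vector_field vector_fields_scale[OF U]
    vector_fields_add[OF U] field_deriv_smooth[OF U]
  have "nabla X (nabla Y (\<lambda>q. f q *\<^sub>R Z q)) p =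
      nabla X (\<lambda>q. field_deriv A Y f q *\<^sub>R Z q + f q *\<^sub>R nabla Y Z q) p"
    if "X \<in> V U" "Y \<in> V U" for X Y
    by (rule nabla_cong) (simp_all add: V nabla_scale_right p that)
  then show ?thesis
    by (simp add: curvature_def nabla_add_right nabla_scale_right V p
        field_deriv_lie_bracket[OF U] algebra_simps)
qed

text \<open>XY - YX - [X, Y] annihilates the function g(Z, W). Expanding by metric compatibility,
  the terms with one derivative on each factor cancel, leaving g(R(X, Y)Z, W) + g(Z, R(X, Y)W) =
  0.\<close>

lemma curvature_metric_skew:
  assumes X: "X \<in> V U" "Y \<in> V U" "Z \<in> V U" "W \<in> V U" and p: "p \<in> U"
  shows "g p (R X Y Z p) (W p) = - g p (Z p) (R X Y W p)"
proof -
  note V = X nabla_vector_field lie_bracket_vector_field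
  let ?f = "\<lambda>q. g q (Z q) (W q)"
  have f: "?f \<in> S U" by (simp add: metric_smooth V)
  have *: "field_deriv A X (field_deriv A Y ?f) p =
      g p (nabla X (nabla Y Z) p) (W p) + g p (nabla Y Z p) (nabla X W p) +
      (g p (nabla X Z p) (nabla Y W p) + g p (Z p) (nabla X (nabla Y W) p))"
    if "X \<in> V U" "Y \<in> V U" for X Y
  proof -
    have "field_deriv A X (field_deriv A Y ?f) p =
        field_deriv A X (\<lambda>q. g q (nabla Y Z q) (W q) + g q (Z q) (nabla Y W q)) p"
      by (rule field_deriv_cong[OF U]) (simp_all add: field_deriv_smooth[OF U] f that
          metric_compatible V p)
    then show ?thesis
      by (simp add: field_deriv_add[OF U] metric_smooth V that metric_compatible p)
  qed
  have "field_deriv A (lie_bracket A X Y) ?f p =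
      field_deriv A X (field_deriv A Y ?f) p - field_deriv A Y (field_deriv A X ?f) p"
    by (rule field_deriv_lie_bracket[OF U X(1,2) f p])
  then show ?thesis
    using in_U[OF U p] unfolding curvature_def *[OF X(1,2)] *[OF X(2,1)]
    by (simp add: metric_compatible V p metric_simps)
qed

text \<open>The three double brackets are evaluated on the coordinate functions near p, where they
  become words of length three in the derivations X, Y, Z that cancel in pairs.\<close>

lemma jacobi_identity:
  assumes X: "X \<in> V U" "Y \<in> V U" "Z \<in> V U" and p: "p \<in> U"
  shows "lie_bracket A X (lie_bracket A Y Z) p + lie_bracket A Y (lie_bracket A Z X) p +
    lie_bracket A Z (lie_bracket A X Y) p = 0"
proof -
  let ?c = "chart_at A p" and ?L = "lie_bracket A"
  note c = chart_at[OF in_U[OF U p]]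
  let ?W = "U \<inter> fst ?c"
  have W: "openin M ?W" "p \<in> ?W" using U p openin_chart[OF c(1)] c by auto
  have XW: "X \<in> V ?W" "Y \<in> V ?W" "Z \<in> V ?W" using X vector_fields_subset by blast+
  have L: "?L X Y \<in> V ?W" if "X \<in> V U" "Y \<in> V U" for X Y
    using lie_bracket_vector_field[OF that] vector_fields_subset by blast
  have "(?L X (?L Y Z) p + ?L Y (?L Z X) p + ?L Z (?L X Y) p) $ k = 0" for k
  proof -
    let ?f = "\<lambda>q. snd ?c q $ k"
    have f: "?f \<in> S ?W" using coord_fun_smooth[OF c(1)] smooth_funs_subset by blast
    have F: "field_deriv A X ?f \<in> S ?W" if "X \<in> V ?W" for X
      using field_deriv_smooth[OF W(1) that f] .
    have F2: "field_deriv A X (field_deriv A Y ?f) \<in> S ?W" if "X \<in> V ?W" "Y \<in> V ?W" for X Y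
      using field_deriv_smooth[OF W(1) that(1) F[OF that(2)]] .
    \<comment> \<open>At p itself the preferred chart is the chosen one, so components are
      derivatives of coordinate functions.\<close>
    have k: "X p $ k = field_deriv A X ?f p" for X
      using field_deriv_coord_fun[OF c] comps_at[OF in_U[OF U p]] by simp
    have *: "field_deriv A (?L X (?L Y Z)) ?f p =
        field_deriv A X (field_deriv A Y (field_deriv A Z ?f)) p
        - field_deriv A X (field_deriv A Z (field_deriv A Y ?f)) p
        - field_deriv A Y (field_deriv A Z (field_deriv A X ?f)) p
        + field_deriv A Z (field_deriv A Y (field_deriv A X ?f)) p"
      if X: "X \<in> V U" "Y \<in> V U" "Z \<in> V U" and XW: "X \<in> V ?W" "Y \<in> V ?W" "Z \<in> V ?W" for X Y Z
    proof -
      have "field_deriv A X (field_deriv A (?L Y Z) ?f) p = field_deriv A X (\<lambda>q.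
          field_deriv A Y (field_deriv A Z ?f) q - field_deriv A Z (field_deriv A Y ?f) q) p"
        by (rule field_deriv_cong[OF W(1)])
          (simp_all add: field_deriv_smooth[OF W(1)] f L X XW
            field_deriv_lie_bracket[OF W(1)] p c)
      then show ?thesis
        using field_deriv_lie_bracket[OF W(1) XW(1) L[OF X(2,3)] f W(2)]
          field_deriv_lie_bracket[OF W(1) XW(2,3) F[OF XW(1)] W(2)]
          field_deriv_diff[OF W(1) F2[OF XW(2,3)] F2[OF XW(3,2)] W(2), of X]
        by simp
    qed
    show ?thesis unfolding vector_add_component k
      by (simp add: * X XW)
  qed
  then show ?thesis by (simp add: vec_eq_iff)
qed

text \<open>Torsion-freeness rewrites each double bracket in terms of \<open>nabla\<close>; the
  cyclic sum of these expressions is, after regrouping, the cyclic sum of R.\<close>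

lemma first_bianchi:
  assumes X: "X \<in> V U" "Y \<in> V U" "Z \<in> V U" and p: "p \<in> U"
  shows "R X Y Z p + R Y Z X p + R Z X Y p = 0"
proof -
  note V = nabla_vector_field lie_bracket_vector_field
  have *: "lie_bracket A X (lie_bracket A Y Z) p =
      nabla X (nabla Y Z) p - nabla X (nabla Z Y) p - nabla (lie_bracket A Y Z) X p"
    if "X \<in> V U" "Y \<in> V U" "Z \<in> V U" for X Y Z
  proof -
    have "nabla X (lie_bracket A Y Z) p = nabla X (\<lambda>q. nabla Y Z q - nabla Z Y q) p"
      by (rule nabla_cong) (simp_all add: V that torsion_free p)
    then show ?thesis using that p torsion_free[of X "lie_bracket A Y Z" p]
      by (simp add: V nabla_diff_right)
  qed
  show ?thesis
    using jacobi_identity[OF X p] by (simp add: * X curvature_def algebra_simps)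
qed

end

section \<open>Dependence of the curvature on the values of the fields\<close>

lemma curvature_tensorial:
  assumes U: "openin M U" and p: "p \<in> U"
    and V: "X \<in> V U" "Y \<in> V U" "Z \<in> V U" "X' \<in> V U" "Y' \<in> V U" "Z' \<in> V U"
    and eq: "X p = X' p" "Y p = Y' p" "Z p = Z' p"
  shows "R X Y Z p = R X' Y' Z' p"
proof -
  have 1: "R X Y Z p = R X' Y Z p"
    if V: "X \<in> V U" "X' \<in> V U" "Y \<in> V U" "Z \<in> V U" and eq: "X p = X' p" for X X' Y Z
  proof (rule tensorial_eq[OF U p V(1,2) eq])
    fix W assume W: "openin M W" "p \<in> W" "W \<subseteq> U"
    then have YZ: "Y \<in> V W" "Z \<in> V W" using V vector_fields_subset by blast+
    show "R X Y Z p = R X' Y Z p" if "X \<in> V W" "X' \<in> V W" "\<forall>q\<in>W. X q = X' q" for X X'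
      by (rule curvature_cong[OF W(1)]) (use that YZ W in auto)
    show "R (\<lambda>q. X q + X' q) Y Z p = R X Y Z p + R X' Y Z p" if "X \<in> V W" "X' \<in> V W" for X X'
      by (rule curvature_add_1[OF W(1)]) (use that YZ W in auto)
    show "R (\<lambda>q. f q *\<^sub>R X q) Y Z p = f p *\<^sub>R R X Y Z p" if "f \<in> S W" "X \<in> V W" for f X
      by (rule curvature_scale_1[OF W(1)]) (use that YZ W in auto)
  qed
  have 3: "R X Y Z p = R X Y Z' p"
    if V: "Z \<in> V U" "Z' \<in> V U" "X \<in> V U" "Y \<in> V U" and eq: "Z p = Z' p" for X Y Z Z'
  proof (rule tensorial_eq[OF U p V(1,2) eq])
    fix W assume W: "openin M W" "p \<in> W" "W \<subseteq> U"
    then have XY: "X \<in> V W" "Y \<in> V W" using V vector_fields_subset by blast+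
    show "R X Y Z p = R X Y Z' p" if "Z \<in> V W" "Z' \<in> V W" "\<forall>q\<in>W. Z q = Z' q" for Z Z'
      by (rule curvature_cong[OF W(1)]) (use that XY W in auto)
    show "R X Y (\<lambda>q. Z q + Z' q) p = R X Y Z p + R X Y Z' p" if "Z \<in> V W" "Z' \<in> V W" for Z Z'
      by (rule curvature_add_3[OF W(1)]) (use that XY W in auto)
    show "R X Y (\<lambda>q. f q *\<^sub>R Z q) p = f p *\<^sub>R R X Y Z p" if "f \<in> S W" "Z \<in> V W" for f Z
      by (rule curvature_scale_3[OF W(1)]) (use that XY W in auto)
  qed
  have "R X Y Z p = R X' Y Z p" by (rule 1) (use V eq in auto)
  \<comment> \<open>The second slot is exchanged by moving it to the first one and back with
    skew-symmetry.\<close>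
  also have "\<dots> = - R Y X' Z p" by (rule curvature_skew[OF U]) (use V p in auto)
  also have "R Y X' Z p = R Y' X' Z p" by (rule 1) (use V eq in auto)
  also have "- R Y' X' Z p = R X' Y' Z p" by (subst curvature_skew[OF U]) (use V p in auto)
  also have "\<dots> = R X' Y' Z' p" by (rule 3) (use V eq in auto)
  finally show ?thesis .
qed

text \<open>Bridge between the curvature of fields, which can be differentiated, and the tensor at
  one point, where linear algebra applies: constant-component extensions have the same values at
  p.\<close>

lemma curvature_eq:
  assumes U: "openin M U" and p: "p \<in> U" and V: "X \<in> V U" "Y \<in> V U" "Z \<in> V U"
  shows "R X Y Z p = curvature_at A nabla p (X p) (Y p) (Z p)"
proof -
  let ?c = "chart_at A p"
  note pM = in_U[OF U p]
  note c = chart_at[OF pM]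
  let ?W = "U \<inter> fst ?c"
  have W: "openin M ?W" "p \<in> ?W" using U p openin_chart[OF c(1)] c by auto
  have "vec_extension A p v \<in> V ?W" for v
    using vec_extension_vector_field[OF pM] vector_fields_subset by blast
  moreover have "X \<in> V ?W" "Y \<in> V ?W" "Z \<in> V ?W" using V vector_fields_subset by blast+
  ultimately show ?thesis unfolding curvature_at_def
    by (intro curvature_tensorial[OF W]) (simp_all add: vec_extension_at pM)
qed

section \<open>The curvature tensor on one tangent space\<close>

context
  fixes p assumes p: "p \<in> topspace M"
begin

abbreviation (input) "Rp \<equiv> curvature_at A nabla p"

lemma chart_dom: "openin M (fst (chart_at A p))" "p \<in> fst (chart_at A p)"
  using chart_at[OF p] openin_chart by auto

lemma curvature_at_eqI:
  assumes "X \<in> V (fst (chart_at A p))" "Y \<in> V (fst (chart_at A p))" "Z \<in> V (fst (chart_at A p))"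
    "X p = u" "Y p = v" "Z p = w"
  shows "Rp u v w = R X Y Z p"
  using curvature_eq[OF chart_dom assms(1-3)] assms(4-6) by simp

lemma curvature_at_skew: "Rp u v w = - Rp v u w"
  unfolding curvature_at_def
  by (rule curvature_skew[OF chart_dom(1) _ _ _ chart_dom(2)])
    (intro vec_extension_vector_field p)+

lemma curvature_at_metric_skew: "g p (Rp u v w) z = - g p w (Rp u v z)"
  using curvature_metric_skew[OF chart_dom(1) _ _ _ _ chart_dom(2), of "vec_extension A p u"
    "vec_extension A p v" "vec_extension A p w" "vec_extension A p z"]
  by (simp add: curvature_at_def vec_extension_vector_field vec_extension_at p)

lemma curvature_at_bianchi: "Rp u v w + Rp v w u + Rp w u v = 0"
  unfolding curvature_at_def
  by (rule first_bianchi[OF chart_dom(1) _ _ _ chart_dom(2)])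
    (intro vec_extension_vector_field p)+

lemma linear_curvature_at_1: "linear (\<lambda>u. Rp u v w)"
proof
  note E = vec_extension_vector_field[OF p]
  show "Rp (u + u') v w = Rp u v w + Rp u' v w" for u u'
  proof -
    have "Rp (u + u') v w = R (\<lambda>q. vec_extension A p u q + vec_extension A p u' q)
        (vec_extension A p v) (vec_extension A p w) p"
      by (rule curvature_at_eqI) (simp_all add: E vec_extension_at p vector_fields_add chart_dom)
    then show ?thesis
      unfolding curvature_at_def by (simp add: curvature_add_1[OF chart_dom(1)] chart_dom E)
  qed
  show "Rp (r *\<^sub>R u) v w = r *\<^sub>R Rp u v w" for r u
  proof -
    have "Rp (r *\<^sub>R u) v w = R (\<lambda>q. (\<lambda>_. r) q *\<^sub>R vec_extension A p u q)
        (vec_extension A p v) (vec_extension A p w) p"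
      by (rule curvature_at_eqI) (simp_all add: E vec_extension_at p vector_fields_cscale chart_dom)
    then show ?thesis
      unfolding curvature_at_def
      using curvature_scale_1[OF chart_dom(1) smooth_funs_const E E E chart_dom(2)] by simp
  qed
qed

lemma linear_curvature_at_2: "linear (\<lambda>v. Rp u v w)"
  using linear_compose_neg[OF linear_curvature_at_1[of u w]]
  by (simp add: curvature_at_skew[of u])

lemma linear_curvature_at_3: "linear (\<lambda>w. Rp u v w)"
proof
  note E = vec_extension_vector_field[OF p]
  show "Rp u v (w + w') = Rp u v w + Rp u v w'" for w w'
  proof -
    have "Rp u v (w + w') = R (vec_extension A p u) (vec_extension A p v)
        (\<lambda>q. vec_extension A p w q + vec_extension A p w' q) p"
      by (rule curvature_at_eqI) (simp_all add: E vec_extension_at p vector_fields_add chart_dom)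
    then show ?thesis
      unfolding curvature_at_def by (simp add: curvature_add_3[OF chart_dom(1)] chart_dom E)
  qed
  show "Rp u v (r *\<^sub>R w) = r *\<^sub>R Rp u v w" for r w
  proof -
    have "Rp u v (r *\<^sub>R w) = R (vec_extension A p u) (vec_extension A p v)
        (\<lambda>q. (\<lambda>_. r) q *\<^sub>R vec_extension A p w q) p"
      by (rule curvature_at_eqI) (simp_all add: E vec_extension_at p vector_fields_cscale chart_dom)
    then show ?thesis
      unfolding curvature_at_def
      using curvature_scale_3[OF chart_dom(1) smooth_funs_const E E E chart_dom(2)] by simp
  qed
qed

end

end

section \<open>Three-dimensional quasi-para-Sasakian manifolds\<close>

lemma locally_constant_imp_constant_on:
  assumes "connected_space X"
    and "\<And>p. p \<in> topspace X \<Longrightarrow> \<exists>W. openin X W \<and> p \<in> W \<and> (\<forall>q\<in>W. f q = f p)"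
  shows "f constant_on topspace X"
proof (cases "topspace X = {}")
  case False
  then obtain p where p: "p \<in> topspace X" by blast
  let ?T = "{q \<in> topspace X. f q = f p}"
  \<comment> \<open>Stated for an arbitrary predicate on values, so that one argument makes both the
    level set and its complement open.\<close>
  have op: "openin X {q \<in> topspace X. P (f q)}" for P
  proof (subst openin_subopen, intro ballI)
    fix q assume q: "q \<in> {q \<in> topspace X. P (f q)}"
    then obtain W where "openin X W" "q \<in> W" "\<forall>r\<in>W. f r = f q" using assms(2) by blast
    then show "\<exists>T. openin X T \<and> q \<in> T \<and> T \<subseteq> {q \<in> topspace X. P (f q)}"
      using q openin_subset by (intro exI[of _ W]) fastforce
  qed
  have "topspace X - ?T = {q \<in> topspace X. f q \<noteq> f p}" by blast
  then have "openin X ?T \<and> closedin X ?T"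
    using op[of "\<lambda>x. x = f p"] op[of "\<lambda>x. x \<noteq> f p"] by (simp add: closedin_def)
  then have "?T = {} \<or> ?T = topspace X"
    using assms(1) by (meson connected_space_clopen_in)
  then show ?thesis using p by (auto simp: constant_on_def)
qed (simp add: constant_on_def)

text \<open>Traces run over the standard basis, which is adapted neither to \<xi> nor to g; this
  contraction evaluates them without a change of basis.\<close>

lemma sum_axis_linear:
  fixes \<alpha> :: "real^'n::finite \<Rightarrow> real"
  assumes "linear \<alpha>"
  shows "(\<Sum>i\<in>UNIV. \<alpha> (axis i 1) * x $ i) = \<alpha> x"
proof -
  have "(\<Sum>i\<in>UNIV. \<alpha> (axis i 1) * x $ i) = \<alpha> (\<Sum>i\<in>UNIV. (x $ i) *\<^sub>R axis i 1)"
    by (simp add: linear_sum[OF assms] linear_scale[OF assms] mult.commute)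
  then show ?thesis using basis_expansion[of x] by (simp add: scalar_mult_eq_scaleR)
qed

lemma trace_axis: "trace (matrix f) = (\<Sum>i\<in>UNIV. f (axis i 1) $ i)"
  by (simp add: trace_def matrix_def)

locale quasi_para_sasakian_mfd3 = levi_civita_mfd M A g nabla
  for M :: "'a topology" and A :: "('a, 3) chart set"
    and g :: "'a \<Rightarrow> real^3 \<Rightarrow> real^3 \<Rightarrow> real"
    and nabla :: "('a \<Rightarrow> real^3) \<Rightarrow> ('a \<Rightarrow> real^3) \<Rightarrow> 'a \<Rightarrow> real^3" +
  fixes phi :: "'a \<Rightarrow> real^3 \<Rightarrow> real^3"
    and eta :: "'a \<Rightarrow> real^3 \<Rightarrow> real"
    and xi :: "'a \<Rightarrow> real^3"
  assumes quasi_para_sasakian: "quasi_para_sasakian M A phi eta xi g nabla"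
begin

lemma almost_paracontact: "almost_paracontact_metric M A phi eta xi g"
  using quasi_para_sasakian by (simp add: quasi_para_sasakian_def)

section \<open>Linear algebra of the structure at one point\<close>

context
  fixes p assumes p: "p \<in> topspace M"
begin

lemma linear_phi: "linear (phi p)" and linear_eta: "linear (eta p)"
  and phi_xi: "phi p (xi p) = 0" and eta_phi: "eta p (phi p v) = 0"
  and eta_xi: "eta p (xi p) = 1"
  and phi_phi: "phi p (phi p v) = v - eta p v *\<^sub>R xi p"
  and metric_phi_phi: "g p (phi p u) (phi p v) = - g p u v + eta p u * eta p v"
  using almost_paracontact p by (simp_all add: almost_paracontact_metric_def)

lemmas eta_simps = linear_add[OF linear_eta] linear_diff[OF linear_eta] linear_neg[OF linear_eta]
  linear_scale[OF linear_eta] linear_0[OF linear_eta]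
lemmas phi_simps = linear_add[OF linear_phi] linear_diff[OF linear_phi] linear_neg[OF linear_phi]
  linear_scale[OF linear_phi] linear_0[OF linear_phi]
lemmas g_simps = metric_simps[OF p]

lemma metric_xi: "g p u (xi p) = eta p u"
  using metric_phi_phi[of u "xi p"] by (simp add: phi_xi eta_xi g_simps)

lemma metric_xi': "g p (xi p) u = eta p u"
  using metric_xi metric_commute[OF p] by simp

lemma metric_phi_skew: "g p (phi p u) v = - g p u (phi p v)"
  using metric_phi_phi[of u "phi p v"] by (simp add: phi_phi eta_phi g_simps metric_xi)

lemma metric_phi_self: "g p u (phi p u) = 0" "g p (phi p u) u = 0"
  using metric_phi_skew[of u u] metric_commute[OF p, of u "phi p u"] by simp_all

text \<open>If all of D were null, polarization would make g vanish on D; as D is also orthogonal to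
  \<xi>, nondegeneracy would force D = 0, which a plane is not.\<close>

lemma ex_nonnull: "\<exists>e. eta p e = 0 \<and> g p e e \<noteq> 0"
proof (rule ccontr)
  assume "\<not> ?thesis"
  then have null: "g p e e = 0" if "eta p e = 0" for e using that by blast
  have D: "g p u v = 0" if "eta p u = 0" "eta p v = 0" for u v
    using null[of "u + v"] null[of u] null[of v] that metric_commute[OF p, of v u]
    by (simp add: g_simps eta_simps)
  have zero: "u = 0" if "eta p u = 0" for u
  proof (rule metric_nondegenerate[OF p])
    fix v
    have "g p u (v - eta p v *\<^sub>R xi p) = 0"
      using that by (intro D) (simp_all add: eta_simps eta_xi)
    then show "g p u v = 0" by (simp add: g_simps metric_xi that)
  qed
  \<comment> \<open>The combination \<eta>(v)u - \<eta>(u)v always lies in D. If it vanishes,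
    independence of u and v gives \<eta>(u) = 0, and then the nonzero u is itself in D.\<close>
  let ?u = "axis 1 1 :: real^3" and ?v = "axis 2 1 :: real^3"
  have "eta p ?v *\<^sub>R ?u - eta p ?u *\<^sub>R ?v = 0"
    by (rule zero) (simp add: eta_simps)
  then have "(eta p ?v *\<^sub>R ?u - eta p ?u *\<^sub>R ?v) $ 2 = 0" by simp
  then have "eta p ?u = 0" by (simp add: axis_def)
  then have "?u = 0" by (rule zero)
  then show False by simp
qed

context
  fixes e assumes e: "eta p e = 0" "g p e e \<noteq> 0"
begin

lemma frame_metric:
  "g p (phi p e) (phi p e) = - g p e e" "g p e (phi p e) = 0" "g p (phi p e) e = 0"
  "g p (xi p) e = 0" "g p e (xi p) = 0" "g p (xi p) (phi p e) = 0" "g p (phi p e) (xi p) = 0"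
  "g p (xi p) (xi p) = 1" "phi p (phi p e) = e"
  by (simp_all add: metric_phi_phi e metric_phi_self metric_xi metric_xi' eta_phi eta_xi phi_phi)

text \<open>The frame is orthogonal with squares 1, g(e, e) and -g(e, e), all nonzero. Pairing with
  it recovers the coefficients, so \<open>?L\<close> is injective and hence surjective in dimension
  3.\<close>

lemma frame_expand:
  obtains a b c where "u = a *\<^sub>R xi p + b *\<^sub>R e + c *\<^sub>R phi p e"
proof -
  let ?L = "\<lambda>x :: real^3. (x $ 1) *\<^sub>R xi p + (x $ 2) *\<^sub>R e + (x $ 3) *\<^sub>R phi p e"
  have lin: "linear ?L"
    by (rule linearI) (simp_all add: algebra_simps)
  have "inj ?L"
    unfolding linear_injective_0[OF lin]
  proof (intro allI impI)
    fix x assume x: "?L x = 0"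
    have "g p (?L x) (xi p) = 0" "g p (?L x) e = 0" "g p (?L x) (phi p e) = 0"
      by (simp_all only: x g_simps)
    then show "x = 0" using e by (simp add: g_simps frame_metric vec_eq_iff forall_3)
  qed
  then have "surj ?L" using linear_injective_imp_surjective[OF lin] by blast
  then obtain x where "u = ?L x" unfolding surj_def by blast
  then show ?thesis by (rule that)
qed

lemma frame_eqI:
  assumes "g p x (xi p) = g p y (xi p)" "g p x e = g p y e" "g p x (phi p e) = g p y (phi p e)"
  shows "x = y"
proof -
  have "x - y = 0"
  proof (rule metric_nondegenerate[OF p])
    fix v
    obtain a b c where "v = a *\<^sub>R xi p + b *\<^sub>R e + c *\<^sub>R phi p e" by (rule frame_expand)
    then show "g p (x - y) v = 0" using assms by (simp add: g_simps)
  qed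
  then show ?thesis by simp
qed

lemma frame_linear_eq:
  assumes "linear L" "linear L'"
    and "L (xi p) = L' (xi p)" "L e = L' e" "L (phi p e) = L' (phi p e)"
  shows "L v = L' v"
proof -
  obtain a b c where v: "v = a *\<^sub>R xi p + b *\<^sub>R e + c *\<^sub>R phi p e" by (rule frame_expand)
  show ?thesis unfolding v using assms(3-5)
    by (simp add: linear_add[OF assms(1)] linear_add[OF assms(2)]
        linear_scale[OF assms(1)] linear_scale[OF assms(2)])
qed

end

end

section \<open>Consequences of the structure equation for \<xi>\<close>

context
  fixes U assumes U: "openin M U"
begin

lemma xi_vector_field: "xi \<in> V U"
  using almost_paracontact vector_fields_subset[OF _ openin_subset[OF U]]
  by (simp add: almost_paracontact_metric_def)

lemma phi_vector_field: "X \<in> V U \<Longrightarrow> (\<lambda>q. phi q (X q)) \<in> V U"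
  and eta_smooth: "X \<in> V U \<Longrightarrow> (\<lambda>q. eta q (X q)) \<in> S U"
  using almost_paracontact U by (simp_all add: almost_paracontact_metric_def)

lemma nabla_phi:
  "X \<in> V U \<Longrightarrow> Y \<in> V U \<Longrightarrow> p \<in> U \<Longrightarrow> nabla X (\<lambda>q. phi q (Y q)) p =
   phi p (nabla X Y p) + g p (X p) (Y p) *\<^sub>R xi p - eta p (Y p) *\<^sub>R X p"
  using quasi_para_sasakian U by (simp add: quasi_para_sasakian_def algebra_simps)

text \<open>Differentiating \<phi>\<xi> = 0 with the structure equation gives \<phi> of the
  derivative of \<xi>; applying \<phi> again determines that derivative up to a multiple of
  \<xi>.\<close>

lemma nabla_xi:
  assumes X: "X \<in> V U" and p: "p \<in> U"
  shows "nabla X xi p = phi p (X p)"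
proof -
  note pM = in_U[OF U p] and V = X xi_vector_field
  \<comment> \<open>The zero field is written as \<xi> - \<xi>, so that additivity shows its
    derivative to vanish.\<close>
  have "nabla X (\<lambda>q. phi q (xi q)) p = nabla X (\<lambda>q. xi q - xi q) p"
    by (rule nabla_cong[OF U]) (simp_all add: V phi_vector_field p phi_xi in_U[OF U])
  also have "\<dots> = 0" using nabla_diff_right[OF U X V(2) V(2) p] by simp
  finally have "phi p (nabla X xi p) = X p - eta p (X p) *\<^sub>R xi p"
    using nabla_phi[OF X xi_vector_field p] by (simp add: metric_xi eta_xi pM eq_neg_iff_add_eq_0 algebra_simps)
  then have "phi p (phi p (nabla X xi p)) = phi p (X p)"
    by (simp add: phi_simps[OF pM] phi_xi[OF pM])
  then have 1: "nabla X xi p - eta p (nabla X xi p) *\<^sub>R xi p = phi p (X p)"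
    by (simp add: phi_phi[OF pM])
  \<comment> \<open>The remaining \<xi> component vanishes because g(\<xi>, \<xi>) = 1 is
    constant.\<close>
  have "field_deriv A X (\<lambda>q. g q (xi q) (xi q)) p = field_deriv A X (\<lambda>q. 1) p"
    by (rule field_deriv_cong[OF U])
      (simp_all add: metric_smooth[OF U] V p metric_xi eta_xi in_U[OF U])
  then have "eta p (nabla X xi p) = 0"
    by (simp add: metric_compatible[OF U] V p field_deriv_const metric_xi metric_xi' pM)
  with 1 show ?thesis by simp
qed

text \<open>As the derivative of \<xi> along Y is \<phi>Y, the structure equation applies once more.
  The terms g(X, Y)\<xi> cancel by symmetry, and the \<phi> terms add up to \<phi>[X, Y], which the
  bracket term removes.\<close>

lemma curvature_xi:
  assumes V: "X \<in> V U" "Y \<in> V U" and p: "p \<in> U"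
  shows "R X Y xi p = eta p (X p) *\<^sub>R Y p - eta p (Y p) *\<^sub>R X p"
proof -
  note pM = in_U[OF U p]
  have *: "nabla X (nabla Y xi) p =
      phi p (nabla X Y p) + g p (X p) (Y p) *\<^sub>R xi p - eta p (Y p) *\<^sub>R X p"
    if "X \<in> V U" "Y \<in> V U" for X Y
  proof -
    have "nabla X (nabla Y xi) p = nabla X (\<lambda>q. phi q (Y q)) p"
      by (rule nabla_cong[OF U])
        (simp_all add: that xi_vector_field nabla_vector_field[OF U] nabla_xi p)
    then show ?thesis using nabla_phi[OF that p] by simp
  qed
  show ?thesis
    using metric_commute[OF pM, of "Y p" "X p"]
    by (simp add: curvature_def * V nabla_xi lie_bracket_vector_field[OF U] p torsion_free[OF U]
        phi_simps[OF pM])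
qed

end

text \<open>The shape of the curvature tensor: \<open>K\<close> is the sectional curvature of \<open>ker \<eta>\<close>, and the planes
  containing \<open>\<xi>\<close> have sectional curvature \<open>-1\<close>.\<close>

definition curvature_form :: "'a \<Rightarrow> real \<Rightarrow> real^3 \<Rightarrow> real^3 \<Rightarrow> real^3 \<Rightarrow> real^3" where
  "curvature_form p K u v w = K *\<^sub>R (g p v w *\<^sub>R u - g p u w *\<^sub>R v)
    - (K + 1) *\<^sub>R ((eta p v * eta p w) *\<^sub>R u - (eta p u * eta p w) *\<^sub>R v
        + (g p v w * eta p u - g p u w * eta p v) *\<^sub>R xi p)"

section \<open>Curvature, Ricci tensor and scalar curvature at one point\<close>

context
  fixes p assumes p: "p \<in> topspace M"
begin

lemma linear_curvature_form:
  "linear (\<lambda>u. curvature_form p K u v w)" "linear (\<lambda>v. curvature_form p K u v w)"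
  "linear (\<lambda>w. curvature_form p K u v w)"
  by (rule linearI; simp add: curvature_form_def g_simps[OF p] eta_simps[OF p] algebra_simps)+

lemma curvature_at_xi_3: "curvature_at A nabla p u v (xi p) = eta p u *\<^sub>R v - eta p v *\<^sub>R u"
proof -
  note E = vec_extension_vector_field[OF p] vec_extension_at[OF p] chart_dom[OF p]
  show ?thesis
    using curvature_xi[OF chart_dom(1)[OF p] E(1) E(1) chart_dom(2)[OF p], of u v]
      curvature_at_eqI[OF p E(1) E(1) xi_vector_field[OF chart_dom(1)[OF p]], of u u v v "xi p"]
    by (simp add: E)
qed

text \<open>On \<open>ker \<eta>\<close> the trilinear form \<open>g (R(\<xi>, u)v) w\<close> is symmetric in \<open>u, v\<close> by the Bianchi
  identity and skew in \<open>v, w\<close>, so it vanishes.\<close>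

lemma curvature_at_xi_1:
  assumes "eta p u = 0" "eta p v = 0"
  shows "curvature_at A nabla p (xi p) u v = - g p u v *\<^sub>R xi p"
proof -
  let ?R = "curvature_at A nabla p"
  have sym: "?R (xi p) u v = ?R (xi p) v u" if "eta p u = 0" "eta p v = 0" for u v
    using curvature_at_bianchi[OF p, of "xi p" u v] curvature_at_skew[OF p, of v "xi p" u]
    by (simp add: curvature_at_xi_3 that)
  define b where "b u v w = g p (?R (xi p) u v) w" for u v w
  have b1: "b u v w = b v u w" if "eta p u = 0" "eta p v = 0" for u v w
    unfolding b_def using sym[OF that] by simp
  have b2: "b u v w = - b u w v" for u v w
    unfolding b_def
    using curvature_at_metric_skew[OF p, of "xi p" u v w] metric_commute[OF p, of v] by simp
  \<comment> \<open>Applying the two rules alternately, three times each, returns to the original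
    order of arguments with three sign changes, so b = -b.\<close>
  have b0: "b u v w = 0" if "eta p u = 0" "eta p v = 0" "eta p w = 0" for u v w
    using b1[of u v w] b2[of v u w] b1[of v w u] b2[of w v u] b1[of w u v] b2[of u w v] that by simp
  have "?R (xi p) u v + g p u v *\<^sub>R xi p = 0"
  proof (rule metric_nondegenerate[OF p])
    fix z
    have "b u v (z - eta p z *\<^sub>R xi p) = 0"
      using assms by (intro b0) (simp_all add: eta_simps[OF p] eta_xi[OF p])
    moreover have "b u v (xi p) = - g p u v"
      using b2[of u v "xi p"] assms
      by (simp add: b_def curvature_at_xi_3 eta_xi[OF p] g_simps[OF p])
    ultimately show "g p (?R (xi p) u v + g p u v *\<^sub>R xi p) z = 0"
      by (simp add: b_def g_simps[OF p] metric_xi'[OF p])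
  qed
  then show ?thesis by (simp add: eq_neg_iff_add_eq_0)
qed

text \<open>Both sides are trilinear, so the frame decides. The denominator is g(e, e)g(\<phi>e,
  \<phi>e) = -g(e, e)^2, which explains the sign and the square in K.\<close>

lemma curvature_at_eq_form:
  assumes e: "eta p e = 0" "g p e e \<noteq> 0"
  defines "K \<equiv> - g p (curvature_at A nabla p e (phi p e) (phi p e)) e / (g p e e)\<^sup>2"
  shows "curvature_at A nabla p u v w = curvature_form p K u v w"
proof -
  let ?R = "curvature_at A nabla p" and ?f = "phi p e" and ?h = "g p e e"
  note fm = frame_metric[OF p e] eta_phi[OF p] eta_xi[OF p] e
  note G = g_simps[OF p]
  have self: "?R u u w = 0" for u w
  proof -
    have "?R u u w $ i = - ?R u u w $ i" for i
      by (metis curvature_at_skew[OF p, of u u w] vector_uminus_component)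
    then show ?thesis by (simp add: vec_eq_iff)
  qed
  have wself: "g p (?R u v w) w = 0" for u v w
    using curvature_at_metric_skew[OF p, of u v w w] metric_commute[OF p, of w "?R u v w"] by simp
  have k: "g p (?R e ?f ?f) e = - K * ?h\<^sup>2" using e by (simp add: K_def)
  \<comment> \<open>By skewness this is a pairing with R(e, \<phi>e)\<xi>, which is zero.\<close>
  have x: "g p (?R e ?f w) (xi p) = 0" for w
    using curvature_at_metric_skew[OF p, of e ?f w "xi p"]
    by (simp add: curvature_at_xi_3 fm G)
  \<comment> \<open>Orthogonal to \<xi> and e, hence a multiple of \<phi>e; the factor is K g(e,
    e)^2 divided by g(\<phi>e, \<phi>e) = -g(e, e).\<close>
  have efe: "?R e ?f e = (- K * ?h) *\<^sub>R ?f"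
    by (rule frame_eqI[OF p e])
      (use k curvature_at_metric_skew[OF p, of e ?f e ?f] metric_commute[OF p, of e "?R e ?f ?f"] in
        \<open>simp_all add: x wself fm G power2_eq_square\<close>)
  have eff: "?R e ?f ?f = (- K * ?h) *\<^sub>R e"
    by (rule frame_eqI[OF p e]) (use k in \<open>simp_all add: x wself fm G power2_eq_square\<close>)
  have xR: "?R (xi p) e e = - ?h *\<^sub>R xi p" "?R (xi p) e ?f = 0" "?R (xi p) ?f e = 0"
    "?R (xi p) ?f ?f = ?h *\<^sub>R xi p"
    by (simp_all add: curvature_at_xi_1 fm)
  note swap = curvature_at_skew[OF p, of e "xi p"] curvature_at_skew[OF p, of ?f "xi p"]
    curvature_at_skew[OF p, of ?f e]
  note base = self efe eff xR swap curvature_at_xi_3 curvature_form_def fm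
  \<comment> \<open>Linearity is spent slot by slot: here the third argument becomes arbitrary, then
    the second, then the first.\<close>
  have 1: "?R u v w = curvature_form p K u v w" if "u \<in> {xi p, e, ?f}" "v \<in> {xi p, e, ?f}" for u v
    by (rule frame_linear_eq[OF p e linear_curvature_at_3[OF p] linear_curvature_form(3)];
      use that in \<open>elim insertE emptyE; simp add: base algebra_simps\<close>)
  have 2: "?R u v w = curvature_form p K u v w" if "u \<in> {xi p, e, ?f}" for u
    by (rule frame_linear_eq[OF p e linear_curvature_at_2[OF p] linear_curvature_form(2)])
      (use 1 that in auto)
  show ?thesis
    by (rule frame_linear_eq[OF p e linear_curvature_at_1[OF p] linear_curvature_form(1)])
      (use 2 in auto)
qed

lemma ricci_eq:
  assumes "\<And>u v w. curvature_at A nabla p u v w = curvature_form p K u v w"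
  shows "ricci A nabla p v w = (K - 1) * g p v w - (K + 1) * eta p v * eta p w"
proof -
  have lg: "linear (\<lambda>u. g p u w)" by (rule linearI) (simp_all add: g_simps[OF p])
  have s1: "(\<Sum>i\<in>UNIV. g p (axis i 1) w * x $ i) = g p x w" for x
    by (rule sum_axis_linear[OF lg])
  have s2: "(\<Sum>i\<in>UNIV. eta p (axis i 1) * x $ i) = eta p x" for x
    by (rule sum_axis_linear[OF linear_eta[OF p]])
  \<comment> \<open>The identity part has trace 3 and the map sending u to \<alpha>(u)x has trace
    \<alpha>(x); these produce the coefficients of the next sum.\<close>
  have "ricci A nabla p v w = (\<Sum>i\<in>UNIV. K * g p v w - K * (g p (axis i 1) w * v $ i)
      - (K + 1) * eta p v * eta p w + (K + 1) * eta p w * (eta p (axis i 1) * v $ i)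
      - (K + 1) * g p v w * (eta p (axis i 1) * xi p $ i)
      + (K + 1) * eta p v * (g p (axis i 1) w * xi p $ i))"
    unfolding ricci_def assms trace_axis
    by (intro sum.cong refl) (simp add: curvature_form_def axis_def algebra_simps)
  also have "\<dots> = 3 * (K * g p v w) - K * g p v w - 3 * ((K + 1) * eta p v * eta p w)
      + (K + 1) * eta p w * eta p v - (K + 1) * g p v w * 1 + (K + 1) * eta p v * eta p w"
    by (simp add: sum.distrib sum_subtractf sum_distrib_left[symmetric] s1 s2
        eta_xi[OF p] metric_xi'[OF p])
  finally show ?thesis by (simp add: algebra_simps)
qed

text \<open>The inverse Gram matrix contracts g to 3 and \<eta> \<otimes> \<eta> to \<eta>(\<xi>) =
  1, so the trace is 3(K - 1) - (K + 1).\<close>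

lemma scalar_curvature_eq:
  assumes "\<And>u v w. curvature_at A nabla p u v w = curvature_form p K u v w"
  shows "scalar_curvature A g nabla p = 2 * K - 4"
proof -
  let ?G = "gram_matrix g p" and ?I = "matrix_inv (gram_matrix g p)"
  have Gv: "(?G *v x) $ i = g p (axis i 1) x" for x i
  proof -
    have "linear (\<lambda>x. g p (axis i 1) x)" by (rule linearI) (simp_all add: g_simps[OF p])
    from sum_axis_linear[OF this, of x] show ?thesis
      by (simp add: gram_matrix_def matrix_vector_mult_def)
  qed
  have "x = 0" if "?G *v x = 0" for x
  proof (rule metric_nondegenerate[OF p])
    fix v
    have "linear (\<lambda>v. g p v x)" by (rule linearI) (simp_all add: g_simps[OF p])
    then have "g p v x = (\<Sum>i\<in>UNIV. g p (axis i 1) x * v $ i)"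
      by (rule sum_axis_linear[symmetric])
    also have "\<dots> = 0" using that by (simp add: Gv[symmetric])
    finally show "g p x v = 0" using metric_commute[OF p] by simp
  qed
  then have "invertible ?G"
    using matrix_left_invertible_ker[of ?G] invertible_left_inverse by blast
  then have "\<exists>B. ?G ** B = mat 1 \<and> B ** ?G = mat 1" by (simp add: invertible_def)
  from someI_ex[OF this] have IG: "?I ** ?G = mat 1" by (simp add: matrix_inv_def)
  have 1: "(\<Sum>i\<in>UNIV. \<Sum>j\<in>UNIV. ?I $ i $ j * g p (axis i 1) (axis j 1)) = 3"
  proof -
    have "(\<Sum>i\<in>UNIV. \<Sum>j\<in>UNIV. ?I $ i $ j * g p (axis i 1) (axis j 1)) = trace (?I ** ?G)"
      by (simp add: trace_def matrix_matrix_mult_def gram_matrix_def metric_commute[OF p])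
    then show ?thesis by (simp add: IG trace_def mat_def)
  qed
  have 2: "(\<Sum>i\<in>UNIV. \<Sum>j\<in>UNIV. ?I $ i $ j * (eta p (axis i 1) * eta p (axis j 1))) = 1"
  proof -
    \<comment> \<open>The covector \<eta> is \<xi> with its index lowered by the Gram matrix, so
      raising the index returns \<xi>.\<close>
    have "(\<Sum>j\<in>UNIV. ?I $ i $ j * eta p (axis j 1)) = (?I *v (?G *v xi p)) $ i" for i
      unfolding matrix_vector_mult_def[of ?I] by (simp add: Gv metric_xi[OF p])
    then have "(\<Sum>j\<in>UNIV. ?I $ i $ j * eta p (axis j 1)) = xi p $ i" for i
      by (simp add: matrix_vector_mul_assoc IG)
    then have "(\<Sum>i\<in>UNIV. eta p (axis i 1) * (\<Sum>j\<in>UNIV. ?I $ i $ j * eta p (axis j 1))) = 1"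
      using sum_axis_linear[OF linear_eta[OF p], of "xi p"] by (simp add: eta_xi[OF p])
    then show ?thesis by (simp add: sum_distrib_left mult_ac)
  qed
  have "scalar_curvature A g nabla p =
      (\<Sum>i\<in>UNIV. \<Sum>j\<in>UNIV. (K - 1) * (?I $ i $ j * g p (axis i 1) (axis j 1)) -
        (K + 1) * (?I $ i $ j * (eta p (axis i 1) * eta p (axis j 1))))"
    unfolding scalar_curvature_def ricci_eq[OF assms]
    by (simp add: right_diff_distrib mult_ac)
  also have "\<dots> = (K - 1) * 3 - (K + 1) * 1"
    by (simp only: sum_subtractf sum_distrib_left[symmetric] 1 2)
  finally show ?thesis by simp
qed

end

text \<open>Solves scal = 2K - 4 for K. This makes K a global function that involves no choice of
  frame vector.\<close>

definition Kappa :: "'a \<Rightarrow> real" where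
  "Kappa p = (scalar_curvature A g nabla p + 4) / 2"

lemma Kappa_eq:
  assumes "p \<in> topspace M" "eta p e = 0" "g p e e \<noteq> 0"
  shows "Kappa p = - g p (curvature_at A nabla p e (phi p e) (phi p e)) e / (g p e e)\<^sup>2"
  using scalar_curvature_eq[OF assms(1) curvature_at_eq_form[OF assms]] by (simp add: Kappa_def)

lemma curvature_at_Kappa:
  assumes "p \<in> topspace M"
  shows "curvature_at A nabla p u v w = curvature_form p (Kappa p) u v w"
proof -
  obtain e where e: "eta p e = 0" "g p e e \<noteq> 0" using ex_nonnull[OF assms] by blast
  show ?thesis unfolding Kappa_eq[OF assms e] by (rule curvature_at_eq_form[OF assms e])
qed

text \<open>On a neighbourhood where a smooth field in D stays non-null, the sectional curvature
  quotient expresses \<open>Kappa\<close> through smooth functions.\<close>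

lemma local_frame:
  assumes p: "p \<in> topspace M"
  obtains U E where "openin M U" "p \<in> U" "E \<in> V U" "Kappa \<in> S U"
    "\<And>q. q \<in> U \<Longrightarrow> eta q (E q) = 0" "\<And>q. q \<in> U \<Longrightarrow> g q (E q) (E q) \<noteq> 0"
proof -
  obtain e where e: "eta p e = 0" "g p e e \<noteq> 0" using ex_nonnull[OF p] by blast
  let ?C = "fst (chart_at A p)"
  note C = chart_dom[OF p]
  \<comment> \<open>Projection of the constant-component extension of e to D along \<xi>; at p it
    changes nothing, since \<eta>(e) = 0.\<close>
  define E where "E q = vec_extension A p e q - eta q (vec_extension A p e q) *\<^sub>R xi q" for q
  have EC: "E \<in> V ?C"
    unfolding E_def
    by (intro vector_fields_diff vector_fields_scale eta_smooth xi_vector_field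
        vec_extension_vector_field C p)
  let ?h = "\<lambda>q. g q (E q) (E q)"
  define U where "U = {q \<in> ?C. ?h q \<noteq> 0}"
  have U: "openin M U"
    unfolding U_def by (rule openin_nonzero[OF C(1) metric_smooth[OF C(1) EC EC]])
  have "E p = e" by (simp add: E_def vec_extension_at p e)
  then have pU: "p \<in> U" using e C by (simp add: U_def)
  have E: "E \<in> V U" using EC vector_fields_subset[of E ?C U] by (auto simp: U_def)
  have eta: "eta q (E q) = 0" if "q \<in> U" for q
    using in_U[OF U that] by (simp add: E_def eta_simps eta_xi)
  have h: "?h q \<noteq> 0" if "q \<in> U" for q using that by (simp add: U_def)
  let ?F = "\<lambda>q. phi q (E q)"
  note F = phi_vector_field[OF U E]
  have "(\<lambda>q. (- 1) * g q (R E ?F ?F q) (E q) * (inverse (?h q) * inverse (?h q))) \<in> S U"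
    by (intro smooth_funs_mult[OF U] smooth_funs_const metric_smooth[OF U]
        curvature_vector_field[OF U] smooth_funs_inverse[OF U] E F) (use h in auto)
  then have "Kappa \<in> S U"
    by (rule smooth_funs_cong[OF U])
      (simp add: Kappa_eq[OF in_U[OF U] eta h] curvature_eq[OF U _ E F F] power2_eq_square
        divide_inverse)
  then show ?thesis using that U pU E eta h by blast
qed

text \<open>The derivatives of g and of the fields cancel against the correction terms, except that
  the derivatives of X and Y may leave D. These contribute only multiples of \<xi>, which \<phi>^2
  kills while fixing X and Y.\<close>

lemma nabla_curvature_eq:
  assumes U: "openin M U" and K: "Kappa \<in> S U"
    and V: "W \<in> V U" "X \<in> V U" "Y \<in> V U" "Z \<in> V U"
    and D: "\<And>q. q \<in> U \<Longrightarrow> eta q (X q) = 0" "\<And>q. q \<in> U \<Longrightarrow> eta q (Y q) = 0"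
      "\<And>q. q \<in> U \<Longrightarrow> eta q (Z q) = 0"
    and p: "p \<in> U"
  shows "phi p (phi p (nabla_curvature A nabla W X Y Z p)) =
    field_deriv A W Kappa p *\<^sub>R (g p (Y p) (Z p) *\<^sub>R X p - g p (X p) (Z p) *\<^sub>R Y p)"
proof -
  note pM = in_U[OF U p]
  note nV = nabla_vector_field[OF U]
  let ?k = "\<lambda>Y q. Kappa q * g q (Y q) (Z q)"
  have k: "?k Y \<in> S U" if "Y \<in> V U" for Y
    by (intro smooth_funs_mult[OF U] K metric_smooth[OF U] that V)
  have dk: "field_deriv A W (?k Y) p = Kappa p * (g p (nabla W Y p) (Z p) + g p (Y p) (nabla W Z p))
      + field_deriv A W Kappa p * g p (Y p) (Z p)" if "Y \<in> V U" for Y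
    using field_deriv_mult[OF U K metric_smooth[OF U that V(4)] p] that V p
    by (simp add: metric_compatible[OF U])
  \<comment> \<open>With all three fields in D the terms with K + 1 drop out on the whole of U, so
    this identity of fields can be differentiated.\<close>
  have "R X Y Z q = ?k Y q *\<^sub>R X q - ?k X q *\<^sub>R Y q" if "q \<in> U" for q
    using in_U[OF U that] that V D
    by (simp add: curvature_eq[OF U] curvature_at_Kappa curvature_form_def algebra_simps)
  then have "nabla W (R X Y Z) p = nabla W (\<lambda>q. ?k Y q *\<^sub>R X q - ?k X q *\<^sub>R Y q) p"
    by (intro nabla_cong[OF U] curvature_vector_field[OF U] V p) auto
  also have "\<dots> = field_deriv A W (?k Y) p *\<^sub>R X p + ?k Y p *\<^sub>R nabla W X p
      - (field_deriv A W (?k X) p *\<^sub>R Y p + ?k X p *\<^sub>R nabla W Y p)"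
    by (simp add: nabla_diff_right[OF U] nabla_scale_right[OF U] vector_fields_scale[OF U] V k p)
  finally have "nabla_curvature A nabla W X Y Z p =
      field_deriv A W Kappa p *\<^sub>R (g p (Y p) (Z p) *\<^sub>R X p - g p (X p) (Z p) *\<^sub>R Y p) +
      ((Kappa p + 1) * (g p (Y p) (Z p) * eta p (nabla W X p) -
          g p (X p) (Z p) * eta p (nabla W Y p))) *\<^sub>R xi p"
    using pM p V D
    by (simp add: nabla_curvature_def curvature_eq[OF U] curvature_at_Kappa curvature_form_def nV
        dk algebra_simps)
  then show ?thesis
    using pM p D by (simp add: phi_phi eta_simps eta_xi)
qed

text \<open>For Y in D, differentiating g(Y, \<xi>) = 0 along X gives \<eta> of the derivative of Y
  as -g(Y, \<phi>X). The pairs (E, \<phi>E) and (\<phi>E, E) yield opposite values, hence the factor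
  2.\<close>

lemma eta_lie_bracket_frame:
  assumes U: "openin M U" and E: "E \<in> V U" "\<And>q. q \<in> U \<Longrightarrow> eta q (E q) = 0" and p: "p \<in> U"
  shows "eta p (lie_bracket A E (\<lambda>q. phi q (E q)) p) = 2 * g p (E p) (E p)"
proof -
  let ?F = "\<lambda>q. phi q (E q)"
  note pM = in_U[OF U p]
  note F = phi_vector_field[OF U E(1)] and xi = xi_vector_field[OF U]
  have *: "eta p (nabla X Y p) = - g p (Y p) (phi p (X p))"
    if V: "X \<in> V U" "Y \<in> V U" and eta: "\<And>q. q \<in> U \<Longrightarrow> eta q (Y q) = 0" for X Y
  proof -
    have "field_deriv A X (\<lambda>q. g q (Y q) (xi q)) p = field_deriv A X (\<lambda>q. 0) p"
      by (rule field_deriv_cong[OF U])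
        (simp_all add: metric_smooth[OF U] V xi eta metric_xi in_U[OF U] p)
    then show ?thesis
      using V p pM by (simp add: metric_compatible[OF U] xi field_deriv_const metric_xi nabla_xi[OF U])
  qed
  have "eta p (nabla E ?F p) = g p (E p) (E p)"
    using *[OF E(1) F] in_U[OF U] E(2)[OF p] pM by (simp add: eta_phi metric_phi_phi)
  moreover have "eta p (nabla ?F E p) = - g p (E p) (E p)"
    using *[OF F E(1) E(2)] E(2)[OF p] pM by (simp add: phi_phi)
  ultimately show ?thesis
    using pM by (simp add: torsion_free[OF U E(1) F p] eta_simps)
qed

section \<open>Constancy of K and local \<phi>-symmetry\<close>

lemma Kappa_constant_imp_phi_symmetric:
  assumes "Kappa constant_on topspace M"
  shows "locally_phi_symmetric M A phi xi g nabla"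
  unfolding locally_phi_symmetric_def
proof (intro allI impI ballI)
  fix U W X Y Z p
  assume U: "openin M U" and V: "W \<in> V U" "X \<in> V U" "Y \<in> V U" "Z \<in> V U"
    and D: "\<forall>p\<in>U. g p (W p) (xi p) = 0 \<and> g p (X p) (xi p) = 0 \<and>
      g p (Y p) (xi p) = 0 \<and> g p (Z p) (xi p) = 0" and p: "p \<in> U"
  obtain k where k: "\<And>q. q \<in> topspace M \<Longrightarrow> Kappa q = k"
    using assms by (auto simp: constant_on_def)
  have K: "Kappa \<in> S U"
    by (rule smooth_funs_cong[OF U smooth_funs_const[of k]]) (simp add: k in_U[OF U])
  have "field_deriv A W Kappa p = field_deriv A W (\<lambda>_. k) p"
    by (rule field_deriv_cong[OF U K]) (simp_all add: k in_U[OF U] p)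
  then show "phi p (phi p (nabla_curvature A nabla W X Y Z p)) = 0"
    using nabla_curvature_eq[OF U K V _ _ _ p] D in_U[OF U]
    by (simp add: metric_xi field_deriv_const)
qed

lemma phi_symmetric_imp_Kappa_constant:
  assumes "connected_space M" and sym: "locally_phi_symmetric M A phi xi g nabla"
  shows "Kappa constant_on topspace M"
proof (rule locally_constant_imp_constant_on[OF assms(1)])
  fix p assume "p \<in> topspace M"
  then obtain U E where U: "openin M U" and pU: "p \<in> U" and E: "E \<in> V U" and K: "Kappa \<in> S U"
    and eta: "\<And>q. q \<in> U \<Longrightarrow> eta q (E q) = 0" and h: "\<And>q. q \<in> U \<Longrightarrow> g q (E q) (E q) \<noteq> 0"
    using local_frame by blast
  let ?F = "\<lambda>q. phi q (E q)"
  have F: "?F \<in> V U" by (rule phi_vector_field[OF U E])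
  have etaF: "eta q (?F q) = 0" if "q \<in> U" for q using eta_phi in_U[OF U that] by simp
  \<comment> \<open>For the arguments \<phi>E, E, E the tensor factor is g(E, E)\<phi>E, because E
    and \<phi>E are orthogonal; it is nonzero and isolates WK.\<close>
  have WK: "field_deriv A W Kappa q = 0"
    if W: "W \<in> V U" "\<And>q. q \<in> U \<Longrightarrow> eta q (W q) = 0" and q: "q \<in> U" for W q
  proof -
    note qM = in_U[OF U q]
    have "phi q (phi q (nabla_curvature A nabla W ?F E E q)) = 0"
    proof -
      have "\<forall>q\<in>U. g q (W q) (xi q) = 0 \<and> g q (?F q) (xi q) = 0 \<and>
          g q (E q) (xi q) = 0 \<and> g q (E q) (xi q) = 0"
        using W(2) eta etaF in_U[OF U] by (simp add: metric_xi)
      from sym[unfolded locally_phi_symmetric_def, rule_format, OF U W(1) F E E this[rule_format] q]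
      show ?thesis .
    qed
    then have "(field_deriv A W Kappa q * g q (E q) (E q)) *\<^sub>R ?F q = 0"
      using nabla_curvature_eq[OF U K W(1) F E E etaF eta eta q] frame_metric[OF qM eta[OF q] h[OF q]]
      by simp
    moreover have "?F q \<noteq> 0"
      using frame_metric(9)[OF qM eta[OF q] h[OF q]] h[OF q] qM by (auto simp: phi_simps g_simps)
    ultimately show ?thesis using h[OF q] by simp
  qed
  have zero: "field_deriv A (\<lambda>_. v) Kappa q = 0" if q: "q \<in> U" for q v
  proof -
    note qM = in_U[OF U q]
    let ?B = "lie_bracket A E ?F" and ?L = "\<lambda>v. field_deriv A (\<lambda>_. v) Kappa q"
    have lin: "linear ?L" by (rule linear_field_deriv[OF U K q])
    have L: "field_deriv A X Kappa q = ?L (X q)" for X by (simp add: field_deriv_def)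
    \<comment> \<open>The function YK vanishes on all of U and not just at q, so its derivative
      vanishes in every direction; both terms of [E, \<phi>E]K are then zero.\<close>
    have XY: "field_deriv A X (field_deriv A Y Kappa) q = 0"
      if Y: "Y \<in> V U" "\<And>q. q \<in> U \<Longrightarrow> eta q (Y q) = 0" for X Y
    proof -
      have "field_deriv A X (field_deriv A Y Kappa) q = field_deriv A X (\<lambda>_. 0) q"
        by (rule field_deriv_cong[OF U field_deriv_smooth[OF U Y(1) K] WK[OF Y]])
          (simp_all add: q)
      then show ?thesis by (simp add: field_deriv_const)
    qed
    have "?L (?B q) = field_deriv A ?B Kappa q" by (rule L[symmetric])
    then have LB: "?L (?B q) = 0"
      using field_deriv_lie_bracket[OF U E F K q] XY[OF E eta, of ?F] XY[OF F etaF, of E] by simp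
    have LE: "?L (E q) = 0" "?L (?F q) = 0"
      using WK[OF E eta q] WK[OF F etaF q] L by metis+
    note fr = frame_expand[OF qM eta[OF q] h[OF q]]
    obtain a b c where B: "?B q = a *\<^sub>R xi q + b *\<^sub>R E q + c *\<^sub>R ?F q" by (rule fr)
    \<comment> \<open>This coefficient is \<eta>([E, \<phi>E]); being nonzero, it lets the
      differential of K on \<xi> be solved from its zeros on [E, \<phi>E], E and \<phi>E.\<close>
    have "a = 2 * g q (E q) (E q)"
      using eta_lie_bracket_frame[OF U E eta q] eta[OF q] etaF[OF q] qM
      by (simp add: B eta_simps eta_xi)
    then have "?L (xi q) = 0"
      using LB LE h[OF q] by (simp add: B linear_add[OF lin] linear_scale[OF lin])
    moreover obtain a b c where "v = a *\<^sub>R xi q + b *\<^sub>R E q + c *\<^sub>R ?F q" by (rule fr)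
    ultimately show ?thesis using LE by (simp add: linear_add[OF lin] linear_scale[OF lin])
  qed
  show "\<exists>W. openin M W \<and> p \<in> W \<and> (\<forall>q\<in>W. Kappa q = Kappa p)"
    using locally_constant[OF U K pU zero] by metis
qed

end

theorem theorem6p3:
  fixes M :: "'a topology"
    and A :: "('a, 3) chart set"
    and phi :: "'a \<Rightarrow> real^3 \<Rightarrow> real^3"
    and eta :: "'a \<Rightarrow> real^3 \<Rightarrow> real"
    and xi :: "'a \<Rightarrow> real^3"
    and g :: "'a \<Rightarrow> real^3 \<Rightarrow> real^3 \<Rightarrow> real"
    and nabla :: "('a \<Rightarrow> real^3) \<Rightarrow> ('a \<Rightarrow> real^3) \<Rightarrow> 'a \<Rightarrow> real^3"
  assumes "smooth_manifold M A"
    and "connected_space M"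
    and "levi_civita M A g nabla"
    and "quasi_para_sasakian M A phi eta xi g nabla"
  shows "locally_phi_symmetric M A phi xi g nabla \<longleftrightarrow>
         scalar_curvature A g nabla constant_on topspace M"
proof -
  interpret quasi_para_sasakian_mfd3 M A g nabla phi eta xi
    using assms by unfold_locales
      (auto simp: quasi_para_sasakian_def almost_paracontact_metric_def)
  have "scalar_curvature A g nabla constant_on topspace M \<longleftrightarrow> Kappa constant_on topspace M"
    unfolding constant_on_def Kappa_def by (metis add_diff_cancel_right' divide_cancel_right
      zero_neq_numeral)
  then show ?thesis
    using phi_symmetric_imp_Kappa_constant[OF assms(2)] Kappa_constant_imp_phi_symmetric by blast
qed

end
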